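(* (Formal Moser trick.) Let $\mathbb{K}$ be a field of characteristic zero and let $A_t\in\mathcal{T}^{(r,s)}_t$ be an evaluative time-dependent formal tensor field of type $(r,s)$ on $\mathbb{K}^n$. If there exists a time-dependent formal vector field $X_t\in\mathfrak{X}_t$ such that the flow $\varphi_t:\mathbb{K}[[t,x]]\to\mathbb{K}[[t,x]]$ of $X_t$ is evaluative and $$\frac{dA_t}{dt}+\mathcal{L}_{X_t}A_t=0,$$ then for all $\tau\in\mathbb{K}$, the formal tensor fields $A_0,A_\tau\in\mathcal{T}^{(r,s)}$ and the formal diffeomorphism $\varphi_\tau:\mathbb{K}[[x]]\to\mathbb{K}[[x]]$ are related by $\varphi_\tau^*A_\tau=A_0$.
   Context: $\mathbb{K}[[x]]=\mathbb{K}[[x^1,\dots,x^n]]$ and $\mathbb{K}[[t,x]]=\mathbb{K}[[t,x^1,\dots,x^n]]$. All algebra homomorphisms are unital and derivations are $\mathbb{K}$-linear. Formal objects. $\mathfrak{X}$ is the set of derivations of $\mathbb{K}[[x]]$ (formal vector fields), a free $\mathbb{K}[[x]]$-module with basis $\{\partial/\partial x^i\}$; $\Omega^1=\operatorname{Hom}_{\mathbb{K}[[x]]}(\mathfrak{X},\mathbb{K}[[x]])$, with dual basis $\{dx^i\}$; $\mathcal{T}^{(r,s)}=\mathfrak{X}^{\otimes r}\otimes(\Omega^1)^{\otimes s}$ (over $\mathbb{K}[[x]]$, with $\mathcal{T}^{(0,0)}=\mathbb{K}[[x]]$), identified with $\mathbb{K}[[x]]$-multilinear maps $(\Omega^1)^r\times\mathfrak{X}^s\to\mathbb{K}[[x]]$.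 A formal diffeomorphism is a $\mathbb{K}$-algebra automorphism $\varphi$ of $\mathbb{K}[[x]]$. Its pullback is: $\varphi^*f=\varphi(f)$; $\varphi^*Y=\varphi\circ Y\circ\varphi^{-1}$ for $Y\in\mathfrak{X}$; $\varphi^*\omega=\varphi\circ\omega\circ(\varphi^* )^{-1}$ for $\omega\in\Omega^1$; and $(\varphi^*A)(\varphi^*\omega_1,\dots,\varphi^*\omega_r,\varphi^*Y_1,\dots,\varphi^*Y_s)=\varphi\big(A(\omega_1,\dots,\omega_r,Y_1,\dots,Y_s)\big)$ for $A\in\mathcal{T}^{(r,s)}$. Time-dependent objects. $\mathfrak{X}_t$ is the set of derivations of $\mathbb{K}[[t,x]]$ that vanish on $t$ (free over $\mathbb{K}[[t,x]]$ with basis $\{\partial/\partial x^i\}$), $\Omega^1_t$ its $\mathbb{K}[[t,x]]$-dual (basis $\{dx^i\}$), and $\mathcal{T}^{(r,s)}_t=\mathbb{K}[[t,x]]\otimes_{\mathbb{K}[[x]]}\mathcal{T}^{(r,s)}\cong\mathfrak{X}_t^{\otimes r}\otimes(\Omega^1_t)^{\otimes s}$ (over $\mathbb{K}[[t,x]]$), identified with $\mathbb{K}[[t,x]]$-multilinear maps $(\Omega_t^1)^r\times\mathfrak{X}_t^s\to\mathbb{K}[[t,x]]$. For $Z\in\mathfrak{X}_t$ or $Z=\partial/\partial t$, the Lie derivative $\mathcal{L}_Z$ on $\mathcal{T}^{(r,s)}_t$ is given by $\mathcal{L}_Zf=Z(f)$, $\mathcal{L}_ZY=[Z,Y]$, $(\mathcal{L}_Z\omega)(Y)=Z(\omega(Y))-\omega([Z,Y])$,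 extended to all tensors by the Leibniz rule over $\otimes$. Put $\frac{d}{dt}=\mathcal{L}_{\partial/\partial t}$ (it differentiates components with respect to $t$). A formal isotopy is a $\mathbb{K}$-algebra automorphism $\varphi_t$ of $\mathbb{K}[[t,x]]$ with $\varphi_t(t)=t$; it is identified with the $n$-tuple $\varphi(t,x)=(\varphi^1(t,x),\dots,\varphi^n(t,x))$, $\varphi^i=\varphi_t(x^i)$. The flow of $X_t\in\mathfrak{X}_t$ is the unique formal isotopy $\varphi_t$ with $\varphi_t(f)|_{t=0}=f$ and $\frac{\partial}{\partial t}(\varphi_t(f))=\varphi_t(X_t(f))$ for all $f\in\mathbb{K}[[x]]$ (it always exists). Evaluative objects. $f\in\mathbb{K}[[t,x]]$ is evaluative if $f\in\mathbb{K}[t][[x]]$, i.e. the coefficient of each $x^\alpha$ is a polynomial in $t$. $A_t\in\mathcal{T}^{(r,s)}_t$ is evaluative if all its components (in the basis of tensor products of $\partial/\partial x^i$'s and $dx^i$'s) are evaluative; $A_\tau\in\mathcal{T}^{(r,s)}$ is then obtained by substituting $t=\tau\in\mathbb{K}$ in each component. A formal isotopy $\varphi_t$ is evaluative if (i) each $\varphi^i(t,x)$ is evaluative and $\varphi^i(t,0)=0$, and (ii) the matrix $\left(\frac{\partial\varphi^i}{\partial x^j}(t,0)\right)_{i,j}$ is invertible in $\mathrm{Mat}_n(\mathbb{K}[t])$. Then $\varphi_\tau$ denotes the formal diffeomorphism of $\mathbb{K}^n$ determined by $\varphi_\tau(x^i)=\varphi^i(\tau,x)$. *)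

theory Defs
  imports
    "HOL-Analysis.Analysis"
    "HOL-Computational_Algebra.Polynomial_FPS"
    "HOL-Library.Function_Algebras"
begin

section \<open>Formal power series in finitely many variables\<close>

text \<open>A series in the variables \<open>'v\<close> is its family of coefficients, indexed by exponent
  vectors \<open>'v \<Rightarrow> nat\<close>.\<close>

typedef (overloaded) ('a, 'v) mfps = "UNIV :: (('v \<Rightarrow> nat) \<Rightarrow> 'a) set"
  morphisms mcoeff Abs_mfps by simp

setup_lifting type_definition_mfps

lemma mfps_eqI: "(\<And>m. mcoeff f m = mcoeff g m) \<Longrightarrow> f = g"
  by (metis mcoeff_inject ext)

lemma mcoeff_Abs_mfps [simp]: "mcoeff (Abs_mfps c) = c"
  by (simp add: Abs_mfps_inverse)

definition splits :: "('v \<Rightarrow> nat) \<Rightarrow> (('v \<Rightarrow> nat) \<times> ('v \<Rightarrow> nat)) set" where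
  "splits m = {(a, b). a + b = m}"

lemma finite_splits [simp]: "finite (splits (m :: 'v::finite \<Rightarrow> nat))"
proof -
  have "finite (PiE UNIV (\<lambda>v. {..m v}))"
    by (rule finite_PiE) auto
  then have fin: "finite {a. \<forall>v. a v \<le> m v}"
    by (rule finite_subset[rotated]) (auto simp: PiE_def)
  have "splits m \<subseteq> {a. \<forall>v. a v \<le> m v} \<times> {a. \<forall>v. a v \<le> m v}"
    by (auto simp: splits_def)
  then show ?thesis
    using fin by (meson finite_SigmaI finite_subset)
qed

instantiation mfps :: (comm_ring_1, finite) comm_ring_1
begin

lift_definition zero_mfps :: "('a, 'b) mfps" is "\<lambda>_. 0" .
lift_definition one_mfps :: "('a, 'b) mfps" is "\<lambda>m. if m = 0 then 1 else 0" .
lift_definition plus_mfps :: "('a, 'b) mfps \<Rightarrow> ('a, 'b) mfps \<Rightarrow> ('a, 'b) mfps"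
  is "\<lambda>f g m. f m + g m" .
lift_definition minus_mfps :: "('a, 'b) mfps \<Rightarrow> ('a, 'b) mfps \<Rightarrow> ('a, 'b) mfps"
  is "\<lambda>f g m. f m - g m" .
lift_definition uminus_mfps :: "('a, 'b) mfps \<Rightarrow> ('a, 'b) mfps"
  is "\<lambda>f m. - f m" .
lift_definition times_mfps :: "('a, 'b) mfps \<Rightarrow> ('a, 'b) mfps \<Rightarrow> ('a, 'b) mfps"
  is "\<lambda>f g m. \<Sum>(a, b)\<in>splits m. f a * g b" .

instance
proof
  fix f g h :: "('a, 'b) mfps"
  show "f + g + h = f + (g + h)" by transfer (simp add: add.assoc)
  show "f + g = g + f" by transfer (simp add: add.commute)
  show "0 + f = f" by transfer simp
  show "- f + f = 0" by transfer simp
  show "f - g = f + - g" by transfer simp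
  show "(f + g) * h = f * h + g * h"
    by transfer (simp add: distrib_right sum.distrib case_prod_unfold)
  show "(0 :: ('a, 'b) mfps) \<noteq> 1"
    by transfer (metis one_neq_zero)
  show "1 * f = f"
  proof (transfer, rule ext)
    fix f :: "('b \<Rightarrow> nat) \<Rightarrow> 'a" and m
    have "(\<Sum>(a, b)\<in>splits m. (if a = 0 then 1 else 0) * f b)
        = (\<Sum>(a, b)\<in>{(0 :: 'b \<Rightarrow> nat, m)}. (if a = 0 then 1 else 0) * f b)"
      by (rule sum.mono_neutral_right[OF finite_splits]) (auto simp: splits_def split: if_splits)
    then show "(\<Sum>(a, b)\<in>splits m. (if a = 0 then 1 else 0) * f b) = f m"
      by simp
  qed
  show "f * g = g * f"
  proof (transfer, rule ext)
    fix f g :: "('b \<Rightarrow> nat) \<Rightarrow> 'a" and m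
    show "(\<Sum>(a, b)\<in>splits m. f a * g b) = (\<Sum>(a, b)\<in>splits m. g a * f b)"
      by (rule sum.reindex_bij_witness[of _ prod.swap prod.swap])
         (auto simp: splits_def add.commute mult.commute)
  qed
  show "f * g * h = f * (g * h)"
  proof (transfer, rule ext)
    fix f g h :: "('b \<Rightarrow> nat) \<Rightarrow> 'a" and m
    have "(\<Sum>(d, c)\<in>splits m. (\<Sum>(a, b)\<in>splits d. f a * g b) * h c)
        = (\<Sum>p\<in>splits m. \<Sum>q\<in>splits (fst p). f (fst q) * g (snd q) * h (snd p))"
      by (simp add: sum_distrib_right case_prod_unfold)
    also have "\<dots> = (\<Sum>(p, q)\<in>(SIGMA p:splits m. splits (fst p)).
        f (fst q) * g (snd q) * h (snd p))"
      by (rule sum.Sigma) auto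
    also have "\<dots> = (\<Sum>(p, q)\<in>(SIGMA p:splits m. splits (snd p)).
        f (fst p) * (g (fst q) * h (snd q)))"
      by (rule sum.reindex_bij_witness[of _
            "\<lambda>(p, q). ((fst p + fst q, snd q), (fst p, fst q))"
            "\<lambda>(p, q). ((fst q, snd q + snd p), (snd q, snd p))"])
         (auto simp: splits_def add.assoc mult.assoc)
    also have "\<dots> = (\<Sum>p\<in>splits m. \<Sum>q\<in>splits (snd p). f (fst p) * (g (fst q) * h (snd q)))"
      by (rule sum.Sigma[symmetric]) auto
    also have "\<dots> = (\<Sum>(a, d)\<in>splits m. f a * (\<Sum>(b, c)\<in>splits d. g b * h c))"
      by (simp add: sum_distrib_left case_prod_unfold)
    finally show "(\<Sum>(d, c)\<in>splits m. (\<Sum>(a, b)\<in>splits d. f a * g b) * h c)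
        = (\<Sum>(a, d)\<in>splits m. f a * (\<Sum>(b, c)\<in>splits d. g b * h c))" .
  qed
qed

end

definition unit_exp :: "'v \<Rightarrow> 'v \<Rightarrow> nat" where
  "unit_exp v = (\<lambda>w. if w = v then 1 else 0)"

definition mconst :: "'a::zero \<Rightarrow> ('a, 'v) mfps" where
  "mconst c = Abs_mfps (\<lambda>m. if m = 0 then c else 0)"

definition mvar :: "'v \<Rightarrow> ('a::zero_neq_one, 'v) mfps" where
  "mvar v = Abs_mfps (\<lambda>m. if m = unit_exp v then 1 else 0)"

definition pderiv_var :: "'v \<Rightarrow> ('a::semiring_1, 'v) mfps \<Rightarrow> ('a, 'v) mfps" where
  "pderiv_var v f = Abs_mfps (\<lambda>m. of_nat (m v + 1) * mcoeff f (m + unit_exp v))"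

text \<open>For the \<open>n\<close> space variables indexed by \<open>'n\<close>, the ring \<open>K[[x]]\<close> is \<open>('a, 'n) mfps\<close> and
  \<open>K[[t,x]]\<close> is \<open>('a, 'n option) mfps\<close>, where \<open>None\<close> indexes \<open>t\<close> and \<open>Some i\<close> indexes \<open>x\<^sup>i\<close>.\<close>

abbreviation tvar :: "('a::zero_neq_one, 'n option) mfps" where
  "tvar \<equiv> mvar None"

definition K_derivation :: "(('a::comm_ring_1, 'v::finite) mfps \<Rightarrow> ('a, 'v) mfps) \<Rightarrow> bool" where
  "K_derivation D \<longleftrightarrow>
     (\<forall>f g. D (f + g) = D f + D g) \<and>
     (\<forall>c f. D (mconst c * f) = mconst c * D f) \<and>
     (\<forall>f g. D (f * g) = D f * g + f * D g)"

definition K_algebra_automorphism ::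
    "(('a::comm_ring_1, 'v::finite) mfps \<Rightarrow> ('a, 'v) mfps) \<Rightarrow> bool" where
  "K_algebra_automorphism \<phi> \<longleftrightarrow>
     bij \<phi> \<and> \<phi> 1 = 1 \<and>
     (\<forall>f g. \<phi> (f + g) = \<phi> f + \<phi> g) \<and>
     (\<forall>f g. \<phi> (f * g) = \<phi> f * \<phi> g) \<and>
     (\<forall>c f. \<phi> (mconst c * f) = mconst c * \<phi> f)"

lemma mcoeff_mconst_mult:
  "mcoeff (mconst c * f) m = c * mcoeff (f :: ('a::comm_ring_1, 'v::finite) mfps) m"
proof -
  have "(\<Sum>(a, b)\<in>splits m. (if a = 0 then c else 0) * mcoeff f b)
      = (\<Sum>(a, b)\<in>{(0 :: 'v \<Rightarrow> nat, m)}. (if a = 0 then c else 0) * mcoeff f b)"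
    by (rule sum.mono_neutral_right[OF finite_splits]) (auto simp: splits_def split: if_splits)
  then show ?thesis
    by (simp add: mconst_def times_mfps.rep_eq)
qed

lemma sum_splits_shift:
  fixes f g :: "('v::finite \<Rightarrow> nat) \<Rightarrow> 'a::comm_ring_1"
  shows "(\<Sum>(a, b)\<in>splits (m + unit_exp v). of_nat (a v) * f a * g b)
       = (\<Sum>(a, b)\<in>splits m. of_nat (a v + 1) * f (a + unit_exp v) * g b)"
proof -
  let ?S = "{p \<in> splits (m + unit_exp v). fst p v \<noteq> 0}"
  have "(\<Sum>(a, b)\<in>splits (m + unit_exp v). of_nat (a v) * f a * g b)
      = (\<Sum>(a, b)\<in>?S. of_nat (a v) * f a * g b)"
  proof (rule sum.mono_neutral_right[OF finite_splits])
    show "\<forall>p\<in>splits (m + unit_exp v) - ?S. (case p of (a, b) \<Rightarrow> of_nat (a v) * f a * g b) = 0"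
    proof
      fix p assume "p \<in> splits (m + unit_exp v) - ?S"
      then have "fst p v = 0" by blast
      then show "(case p of (a, b) \<Rightarrow> of_nat (a v) * f a * g b) = 0"
        by (simp add: case_prod_unfold)
    qed
  qed blast
  also have "\<dots> = (\<Sum>(a, b)\<in>splits m. of_nat (a v + 1) * f (a + unit_exp v) * g b)"
  proof (rule sum.reindex_bij_witness[of _ "\<lambda>(a, b). (a + unit_exp v, b)" "\<lambda>(a, b). (a - unit_exp v, b)"])
    fix p assume p: "p \<in> ?S"
    obtain a b where ab: "p = (a, b)" by force
    have e: "a - unit_exp v + unit_exp v = a"
      using p ab by (auto simp: unit_exp_def fun_eq_iff)
    show "(case case p of (a, b) \<Rightarrow> (a - unit_exp v, b) of (a, b) \<Rightarrow> (a + unit_exp v, b)) = p"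
      by (simp add: ab e)
    have "(a - unit_exp v + b) + unit_exp v = m + unit_exp v"
    proof -
      have "(a - unit_exp v + b) + unit_exp v = (a - unit_exp v + unit_exp v) + b"
        by (simp only: ac_simps)
      also have "\<dots> = m + unit_exp v"
        unfolding e using p ab by (simp add: splits_def)
      finally show ?thesis .
    qed
    then show "(case p of (a, b) \<Rightarrow> (a - unit_exp v, b)) \<in> splits m"
      by (auto simp: ab splits_def fun_eq_iff)
    have "(a - unit_exp v) v + 1 = a v"
      using p ab by (simp add: unit_exp_def)
    then show "(case case p of (a, b) \<Rightarrow> (a - unit_exp v, b) of
        (a, b) \<Rightarrow> of_nat (a v + 1) * f (a + unit_exp v) * g b) =
        (case p of (a, b) \<Rightarrow> of_nat (a v) * f a * g b)"
      by (simp only: ab e prod.case)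
  next
    fix p assume p: "p \<in> splits m"
    obtain a b where ab: "p = (a, b)" by force
    show "(case case p of (a, b) \<Rightarrow> (a + unit_exp v, b) of (a, b) \<Rightarrow> (a - unit_exp v, b)) = p"
      by (simp add: ab fun_eq_iff)
    show "(case p of (a, b) \<Rightarrow> (a + unit_exp v, b)) \<in> ?S"
      using p by (auto simp: ab splits_def fun_eq_iff unit_exp_def)
  qed
  finally show ?thesis .
qed

lemma K_derivation_pderiv_var:
  "K_derivation (pderiv_var v :: ('a::comm_ring_1, 'v::finite) mfps \<Rightarrow> ('a, 'v) mfps)"
proof -
  have "pderiv_var v (f * g) = pderiv_var v f * g + f * pderiv_var v g"
    for f g :: "('a, 'v) mfps"
  proof (rule mfps_eqI)
    fix m
    have swap: "(\<Sum>(a, b)\<in>splits k. F a * G b) = (\<Sum>(b, a)\<in>splits k. F a * G b)"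
      for F G :: "('v \<Rightarrow> nat) \<Rightarrow> 'a" and k
      by (rule sum.reindex_bij_witness[of _ prod.swap prod.swap])
         (auto simp: splits_def add.commute)
    have "mcoeff (pderiv_var v (f * g)) m =
        (\<Sum>(a, b)\<in>splits (m + unit_exp v). of_nat (m v + 1) * (mcoeff f a * mcoeff g b))"
      by (simp add: pderiv_var_def times_mfps.rep_eq sum_distrib_left case_prod_unfold)
    also have "\<dots> = (\<Sum>(a, b)\<in>splits (m + unit_exp v).
        of_nat (a v) * mcoeff f a * mcoeff g b + of_nat (b v) * mcoeff g b * mcoeff f a)"
    proof (rule sum.cong[OF refl], clarify)
      fix a b assume "(a, b) \<in> splits (m + unit_exp v)"
      then have "a v + b v = m v + 1"
        by (auto simp: splits_def fun_eq_iff unit_exp_def split: if_splits)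
      then have "of_nat (m v + 1) = (of_nat (a v) + of_nat (b v) :: 'a)"
        by (metis of_nat_add)
      then show "of_nat (m v + 1) * (mcoeff f a * mcoeff g b) =
          of_nat (a v) * mcoeff f a * mcoeff g b + of_nat (b v) * mcoeff g b * mcoeff f a"
        by (simp only: algebra_simps)
    qed
    also have "\<dots> =
        (\<Sum>(a, b)\<in>splits (m + unit_exp v). of_nat (a v) * mcoeff f a * mcoeff g b) +
        (\<Sum>(a, b)\<in>splits (m + unit_exp v). of_nat (b v) * mcoeff g b * mcoeff f a)"
      by (simp add: case_prod_unfold sum.distrib)
    also have "(\<Sum>(a, b)\<in>splits (m + unit_exp v). of_nat (b v) * mcoeff g b * mcoeff f a) =
        (\<Sum>(a, b)\<in>splits (m + unit_exp v). of_nat (a v) * mcoeff g a * mcoeff f b)"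
      by (rule swap[symmetric])
    also have "\<dots> = mcoeff (pderiv_var v g * f) m"
      unfolding sum_splits_shift by (simp add: pderiv_var_def times_mfps.rep_eq)
    also have "(\<Sum>(a, b)\<in>splits (m + unit_exp v). of_nat (a v) * mcoeff f a * mcoeff g b) =
        mcoeff (pderiv_var v f * g) m"
      unfolding sum_splits_shift by (simp add: pderiv_var_def times_mfps.rep_eq)
    finally show "mcoeff (pderiv_var v (f * g)) m = mcoeff (pderiv_var v f * g + f * pderiv_var v g) m"
      by (simp add: plus_mfps.rep_eq mult.commute)
  qed
  moreover have "pderiv_var v (f + g) = pderiv_var v f + pderiv_var v g"
    for f g :: "('a, 'v) mfps"
    by (rule mfps_eqI) (simp add: pderiv_var_def plus_mfps.rep_eq algebra_simps)
  moreover have "pderiv_var v (mconst c * f) = mconst c * pderiv_var v f"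
    for c and f :: "('a, 'v) mfps"
    by (rule mfps_eqI) (simp add: mcoeff_mconst_mult pderiv_var_def mult.left_commute)
  ultimately show ?thesis
    by (simp add: K_derivation_def)
qed

lemma pderiv_var_mvar:
  "pderiv_var v (mvar w :: ('a::comm_ring_1, 'v::finite) mfps) = (if v = w then 1 else 0)"
proof (rule mfps_eqI)
  fix m :: "'v \<Rightarrow> nat"
  have "m + unit_exp v = unit_exp w \<longleftrightarrow> m = 0 \<and> v = w"
  proof
    assume e: "m + unit_exp v = unit_exp w"
    then have ev: "m u + unit_exp v u = unit_exp w u" for u
      by (metis plus_fun_apply)
    from ev[of v] have "v = w" by (auto simp: unit_exp_def split: if_splits)
    with e show "m = 0 \<and> v = w" by simp
  qed simp
  then show "mcoeff (pderiv_var v (mvar w :: ('a, 'v) mfps)) m = mcoeff (if v = w then 1 else 0) m"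
    by (auto simp: pderiv_var_def mvar_def one_mfps.rep_eq zero_mfps.rep_eq)
qed

lemma K_derivationD:
  assumes "K_derivation D"
  shows "D (f + g) = D f + D g" "D (mconst c * f) = mconst c * D f" "D (f * g) = D f * g + f * D g"
  using assms unfolding K_derivation_def by blast+

lemma K_derivation_0_1:
  assumes "K_derivation D"
  shows "D 0 = 0" "D 1 = 0"
  using K_derivationD(1)[OF assms, of 0 0] K_derivationD(3)[OF assms, of 1 1] by simp_all

lemma K_derivation_mconst:
  assumes "K_derivation D"
  shows "D (mconst c) = 0"
  using K_derivationD(2)[OF assms, of c 1] K_derivation_0_1(2)[OF assms] by simp

lemma K_derivationI:
  assumes "\<And>f g. D (f + g) = D f + D g" "\<And>f g. D (f * g) = D f * g + f * D g"
    "\<And>c. D (mconst c) = 0"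
  shows "K_derivation D"
  using assms by (simp add: K_derivation_def)

section \<open>Tensor fields over a module of vector fields\<close>

text \<open>The notions of this section are used both for formal and for time-dependent formal tensor
  fields: \<open>V\<close> is the module of vector fields (a set of derivations of the ring \<open>'r\<close>). Forms and
  tensors are multilinear maps on carrier sets; they are \<open>0\<close> outside their domain, so that equality
  of functions is equality of tensor fields.\<close>

type_synonym 'r vfield = "'r \<Rightarrow> 'r"
type_synonym 'r oneform = "'r vfield \<Rightarrow> 'r"
type_synonym 'r tensor = "'r oneform list \<Rightarrow> 'r vfield list \<Rightarrow> 'r"

definition one_forms :: "'r::comm_ring_1 vfield set \<Rightarrow> 'r oneform set" where
  "one_forms V = {\<omega>.
     (\<forall>Y\<in>V. \<forall>Z\<in>V. \<omega> (Y + Z) = \<omega> Y + \<omega> Z) \<and>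
     (\<forall>f. \<forall>Y\<in>V. \<omega> (\<lambda>g. f * Y g) = f * \<omega> Y) \<and>
     (\<forall>Y. Y \<notin> V \<longrightarrow> \<omega> Y = 0)}"

definition tensor_args ::
    "'r::comm_ring_1 vfield set \<Rightarrow> nat \<Rightarrow> nat \<Rightarrow> 'r oneform list \<Rightarrow> 'r vfield list \<Rightarrow> bool" where
  "tensor_args V r s \<omega>s Ys \<longleftrightarrow>
     length \<omega>s = r \<and> set \<omega>s \<subseteq> one_forms V \<and> length Ys = s \<and> set Ys \<subseteq> V"

definition tensors :: "'r::comm_ring_1 vfield set \<Rightarrow> nat \<Rightarrow> nat \<Rightarrow> 'r tensor set" where
  "tensors V r s = {A.
     (\<forall>\<omega>s Ys. tensor_args V r s \<omega>s Ys \<longrightarrow>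
        (\<forall>k<r. \<forall>\<alpha>\<in>one_forms V. \<forall>\<beta>\<in>one_forms V. \<forall>f.
           A (\<omega>s[k := \<alpha> + \<beta>]) Ys = A (\<omega>s[k := \<alpha>]) Ys + A (\<omega>s[k := \<beta>]) Ys \<and>
           A (\<omega>s[k := (\<lambda>Y. f * \<alpha> Y)]) Ys = f * A (\<omega>s[k := \<alpha>]) Ys) \<and>
        (\<forall>k<s. \<forall>Y\<in>V. \<forall>Z\<in>V. \<forall>f.
           A \<omega>s (Ys[k := Y + Z]) = A \<omega>s (Ys[k := Y]) + A \<omega>s (Ys[k := Z]) \<and>
           A \<omega>s (Ys[k := (\<lambda>g. f * Y g)]) = f * A \<omega>s (Ys[k := Y]))) \<and>
     (\<forall>\<omega>s Ys. \<not> tensor_args V r s \<omega>s Ys \<longrightarrow> A \<omega>s Ys = 0)}"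

subsection \<open>Lie derivative\<close>

definition lie_bracket :: "'r::comm_ring_1 vfield \<Rightarrow> 'r vfield \<Rightarrow> 'r vfield" where
  "lie_bracket Z Y = (\<lambda>f. Z (Y f) - Y (Z f))"

definition lie_form :: "'r::comm_ring_1 vfield set \<Rightarrow> 'r vfield \<Rightarrow> 'r oneform \<Rightarrow> 'r oneform" where
  "lie_form V Z \<omega> = (\<lambda>Y. if Y \<in> V then Z (\<omega> Y) - \<omega> (lie_bracket Z Y) else 0)"

text \<open>The Leibniz extension of the Lie derivative to tensors of type \<open>(r,s)\<close>, written for
  multilinear maps. The lemmas below show that it has the prescribed values on functions, vector
  fields and forms, that it is additive, and that it satisfies the Leibniz rule over the tensor
  product; \<open>Z\<close> need not belong to \<open>V\<close>.\<close>

definition lie_derivative ::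
    "'r::comm_ring_1 vfield set \<Rightarrow> nat \<Rightarrow> nat \<Rightarrow> 'r vfield \<Rightarrow> 'r tensor \<Rightarrow> 'r tensor" where
  "lie_derivative V r s Z A = (\<lambda>\<omega>s Ys.
     if tensor_args V r s \<omega>s Ys then
       Z (A \<omega>s Ys)
       - (\<Sum>k<r. A (\<omega>s[k := lie_form V Z (\<omega>s ! k)]) Ys)
       - (\<Sum>k<s. A \<omega>s (Ys[k := lie_bracket Z (Ys ! k)]))
     else 0)"

definition function_tensor :: "'r::comm_ring_1 vfield set \<Rightarrow> 'r \<Rightarrow> 'r tensor" where
  "function_tensor V f = (\<lambda>\<omega>s Ys. if tensor_args V 0 0 \<omega>s Ys then f else 0)"

definition vector_tensor :: "'r::comm_ring_1 vfield set \<Rightarrow> 'r vfield \<Rightarrow> 'r tensor" where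
  "vector_tensor V Y = (\<lambda>\<omega>s Ys. if tensor_args V 1 0 \<omega>s Ys then (\<omega>s ! 0) Y else 0)"

definition form_tensor :: "'r::comm_ring_1 vfield set \<Rightarrow> 'r oneform \<Rightarrow> 'r tensor" where
  "form_tensor V \<omega> = (\<lambda>\<omega>s Ys. if tensor_args V 0 1 \<omega>s Ys then \<omega> (Ys ! 0) else 0)"

text \<open>Tensor product of \<open>A\<close> of type \<open>(r,s)\<close> with \<open>B\<close>.\<close>

definition tensor_product :: "nat \<Rightarrow> nat \<Rightarrow> 'r::comm_ring_1 tensor \<Rightarrow> 'r tensor \<Rightarrow> 'r tensor" where
  "tensor_product r s A B =
     (\<lambda>\<omega>s Ys. A (take r \<omega>s) (take s Ys) * B (drop r \<omega>s) (drop s Ys))"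

lemma lie_derivative_function:
  "lie_derivative V 0 0 Z (function_tensor V f) = function_tensor V (Z f)"
  by (intro ext) (simp add: lie_derivative_def function_tensor_def)

lemma lie_derivative_vector:
  assumes Y: "Y \<in> V" and cl: "\<And>\<omega>. \<omega> \<in> one_forms V \<Longrightarrow> lie_form V Z \<omega> \<in> one_forms V"
  shows "lie_derivative V 1 0 Z (vector_tensor V Y) = vector_tensor V (lie_bracket Z Y)"
proof (intro ext)
  fix \<omega>s :: "'a oneform list" and Ys :: "'a vfield list"
  show "lie_derivative V 1 0 Z (vector_tensor V Y) \<omega>s Ys = vector_tensor V (lie_bracket Z Y) \<omega>s Ys"
  proof (cases "tensor_args V 1 0 \<omega>s Ys")
    case True
    then obtain \<omega> where w: "\<omega>s = [\<omega>]" "Ys = []" "\<omega> \<in> one_forms V"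
      by (auto simp: tensor_args_def length_Suc_conv)
    then show ?thesis
      using Y cl[OF w(3)]
      by (simp add: lie_derivative_def vector_tensor_def tensor_args_def lie_form_def)
  qed (simp add: lie_derivative_def vector_tensor_def)
qed

lemma lie_derivative_form:
  assumes cl: "\<And>Y. Y \<in> V \<Longrightarrow> lie_bracket Z Y \<in> V"
  shows "lie_derivative V 0 1 Z (form_tensor V \<omega>) = form_tensor V (lie_form V Z \<omega>)"
proof (intro ext)
  fix \<omega>s :: "'a oneform list" and Ys :: "'a vfield list"
  show "lie_derivative V 0 1 Z (form_tensor V \<omega>) \<omega>s Ys = form_tensor V (lie_form V Z \<omega>) \<omega>s Ys"
  proof (cases "tensor_args V 0 1 \<omega>s Ys")
    case True
    then obtain Y where w: "\<omega>s = []" "Ys = [Y]" "Y \<in> V"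
      by (auto simp: tensor_args_def length_Suc_conv)
    then show ?thesis
      using cl[OF w(3)]
      by (simp add: lie_derivative_def form_tensor_def tensor_args_def lie_form_def)
  qed (simp add: lie_derivative_def form_tensor_def)
qed

lemma lie_derivative_add:
  assumes Z: "\<And>f g. Z (f + g) = Z f + Z g"
  shows "lie_derivative V r s Z (A + B) = lie_derivative V r s Z A + lie_derivative V r s Z B"
  by (intro ext) (simp add: lie_derivative_def Z sum.distrib algebra_simps)

lemma lie_derivative_tensor_product:
  assumes Z: "\<And>f g. Z (f * g) = Z f * g + f * Z g"
  assumes A: "A \<in> tensors V r s" and B: "B \<in> tensors V r' s'"
  shows "lie_derivative V (r + r') (s + s') Z (tensor_product r s A B) =
      tensor_product r s (lie_derivative V r s Z A) B +
      tensor_product r s A (lie_derivative V r' s' Z B)"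
proof (intro ext)
  fix \<omega>s :: "'a oneform list" and Ys :: "'a vfield list"
  let ?l = "lie_derivative V (r + r') (s + s') Z (tensor_product r s A B) \<omega>s Ys"
  let ?u = "take r \<omega>s" and ?u' = "drop r \<omega>s" and ?v = "take s Ys" and ?v' = "drop s Ys"
  have split: "sum g {..<m + m'} = sum g {..<m} + (\<Sum>k<m'. g (m + k))"
    for g :: "nat \<Rightarrow> 'a" and m m'
    by (induction m') (simp_all add: add.assoc)
  have zA: "A us vs = 0" if "\<not> tensor_args V r s us vs" for us vs
    using A that by (auto simp: tensors_def)
  have zB: "B us vs = 0" if "\<not> tensor_args V r' s' us vs" for us vs
    using B that by (auto simp: tensors_def)
  show "?l = (tensor_product r s (lie_derivative V r s Z A) B +
      tensor_product r s A (lie_derivative V r' s' Z B)) \<omega>s Ys"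
  proof (cases "tensor_args V (r + r') (s + s') \<omega>s Ys")
    case False
    have "\<not> (tensor_args V r s ?u ?v \<and> tensor_args V r' s' ?u' ?v')"
    proof
      assume a: "tensor_args V r s ?u ?v \<and> tensor_args V r' s' ?u' ?v'"
      have "length \<omega>s = length ?u + length ?u'" "length Ys = length ?v + length ?v'"
        by (simp_all del: length_take length_drop flip: length_append)
      moreover have "set \<omega>s = set ?u \<union> set ?u'" "set Ys = set ?v \<union> set ?v'"
        by (metis append_take_drop_id set_append)+
      ultimately show False
        using a False unfolding tensor_args_def by auto
    qed
    then show ?thesis
      using False zA zB by (auto simp: lie_derivative_def tensor_product_def)
  next
    case True
    have len: "length \<omega>s = r + r'" "length Ys = s + s'"
      using True by (auto simp: tensor_args_def)
    have args: "tensor_args V r s ?u ?v" "tensor_args V r' s' ?u' ?v'"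
      using True by (auto simp: tensor_args_def dest: in_set_takeD in_set_dropD)
    have 1: "(\<Sum>k<r + r'. tensor_product r s A B (\<omega>s[k := lie_form V Z (\<omega>s ! k)]) Ys) =
      (\<Sum>k<r. A (?u[k := lie_form V Z (?u ! k)]) ?v) * B ?u' ?v' +
      A ?u ?v * (\<Sum>k<r'. B (?u'[k := lie_form V Z (?u' ! k)]) ?v')"
      using len unfolding split
      by (simp add: tensor_product_def sum_distrib_left sum_distrib_right take_update_swap
          drop_update_swap list_update_beyond)
    have 2: "(\<Sum>k<s + s'. tensor_product r s A B \<omega>s (Ys[k := lie_bracket Z (Ys ! k)])) =
      (\<Sum>k<s. A ?u (?v[k := lie_bracket Z (?v ! k)])) * B ?u' ?v' +
      A ?u ?v * (\<Sum>k<s'. B ?u' (?v'[k := lie_bracket Z (?v' ! k)]))"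
      using len unfolding split
      by (simp add: tensor_product_def sum_distrib_left sum_distrib_right take_update_swap
          drop_update_swap list_update_beyond)
    show ?thesis
      using True args
      by (simp add: lie_derivative_def 1 2)
         (simp add: tensor_product_def lie_derivative_def Z algebra_simps)
  qed
qed

subsection \<open>Pullback by a ring automorphism\<close>

definition pullback_vfield :: "('r \<Rightarrow> 'r) \<Rightarrow> 'r::comm_ring_1 vfield \<Rightarrow> 'r vfield" where
  "pullback_vfield \<phi> Y = \<phi> \<circ> Y \<circ> inv \<phi>"

definition pullback_form :: "('r \<Rightarrow> 'r) \<Rightarrow> 'r::comm_ring_1 oneform \<Rightarrow> 'r oneform" where
  "pullback_form \<phi> \<omega> = \<phi> \<circ> \<omega> \<circ> inv (pullback_vfield \<phi>)"

definition pullback_tensor :: "('r \<Rightarrow> 'r) \<Rightarrow> 'r::comm_ring_1 tensor \<Rightarrow> 'r tensor" where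
  "pullback_tensor \<phi> A = (\<lambda>\<omega>s Ys.
     \<phi> (A (map (inv (pullback_form \<phi>)) \<omega>s) (map (inv (pullback_vfield \<phi>)) Ys)))"

lemma bij_pullback_vfield:
  assumes "bij \<phi>" shows "bij (pullback_vfield \<phi>)"
proof (rule o_bij)
  show "(\<lambda>Y. inv \<phi> \<circ> Y \<circ> \<phi>) \<circ> pullback_vfield \<phi> = id"
    using assms by (auto simp: fun_eq_iff pullback_vfield_def bij_is_inj inv_f_f)
  show "pullback_vfield \<phi> \<circ> (\<lambda>Y. inv \<phi> \<circ> Y \<circ> \<phi>) = id"
    using assms by (auto simp: fun_eq_iff pullback_vfield_def bij_is_surj surj_f_inv_f)
qed

lemma bij_pullback_form:
  assumes "bij \<phi>" shows "bij (pullback_form \<phi>)"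
proof (rule o_bij)
  note b = bij_pullback_vfield[OF assms]
  show "(\<lambda>\<omega>. inv \<phi> \<circ> \<omega> \<circ> pullback_vfield \<phi>) \<circ> pullback_form \<phi> = id"
    using assms b by (auto simp: fun_eq_iff pullback_form_def bij_is_inj inv_f_f)
  show "pullback_form \<phi> \<circ> (\<lambda>\<omega>. inv \<phi> \<circ> \<omega> \<circ> pullback_vfield \<phi>) = id"
    using assms b by (auto simp: fun_eq_iff pullback_form_def bij_is_surj surj_f_inv_f)
qed

lemma pullback_tensor_apply:
  assumes "bij \<phi>"
  shows "pullback_tensor \<phi> A (map (pullback_form \<phi>) \<omega>s) (map (pullback_vfield \<phi>) Ys) = \<phi> (A \<omega>s Ys)"
  using bij_is_inj[OF bij_pullback_form[OF assms]] bij_is_inj[OF bij_pullback_vfield[OF assms]]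
  by (simp add: pullback_tensor_def comp_def inv_f_f)

subsection \<open>Coordinate coframe\<close>

definition coord_form :: "'r::comm_ring_1 vfield set \<Rightarrow> 'r \<Rightarrow> 'r oneform" where
  "coord_form V x = (\<lambda>Y. if Y \<in> V then Y x else 0)"

section \<open>Formal and time-dependent formal objects\<close>

definition formal_vfields :: "('a::comm_ring_1, 'n::finite) mfps vfield set" where
  "formal_vfields = {Y. K_derivation Y}"

definition time_vfields :: "('a::comm_ring_1, 'n::finite option) mfps vfield set" where
  "time_vfields = {Y. K_derivation Y \<and> Y tvar = 0}"

lemma pderiv_var_in_time_vfields: "pderiv_var (Some i) \<in> time_vfields"
  by (simp add: time_vfields_def K_derivation_pderiv_var pderiv_var_mvar)

text \<open>The Lie derivatives along \<open>\<partial>/\<partial>t\<close> and along time-dependent vector fields preserve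
  time-dependent vector fields and forms, as required in \<open>lie_derivative_vector\<close> and
  \<open>lie_derivative_form\<close>.\<close>

lemma lie_bracket_in_time_vfields:
  assumes Z: "Z = pderiv_var None \<or> Z \<in> time_vfields" and Y: "Y \<in> time_vfields"
  shows "lie_bracket Z Y \<in> time_vfields"
proof -
  have dZ: "K_derivation Z" and dY: "K_derivation Y" and Yt: "Y tvar = 0"
    using Z Y by (auto simp: time_vfields_def K_derivation_pderiv_var)
  have "Z tvar = 0 \<or> Z tvar = 1"
    using Z by (auto simp: time_vfields_def pderiv_var_mvar)
  then have "lie_bracket Z Y tvar = 0"
    using Yt K_derivation_0_1[OF dZ] K_derivation_0_1[OF dY] by (auto simp: lie_bracket_def)
  moreover have "K_derivation (lie_bracket Z Y)"
    by (rule K_derivationI)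
       (simp_all add: lie_bracket_def K_derivationD(1,3)[OF dZ] K_derivationD(1,3)[OF dY]
          K_derivation_mconst[OF dZ] K_derivation_mconst[OF dY]
          K_derivation_0_1[OF dZ] K_derivation_0_1[OF dY] algebra_simps)
  ultimately show ?thesis by (simp add: time_vfields_def)
qed

lemma lie_form_in_one_forms:
  assumes Z: "Z = pderiv_var None \<or> Z \<in> time_vfields" and w: "\<omega> \<in> one_forms time_vfields"
  shows "lie_form time_vfields Z \<omega> \<in> one_forms time_vfields"
proof -
  let ?V = "time_vfields :: ('a, 'b option) mfps vfield set"
  have dZ: "Z (f + g) = Z f + Z g" "Z (f * g) = Z f * g + f * Z g" for f g
    using Z K_derivation_pderiv_var[of "None :: 'b option", where 'a = 'a]
    by (auto simp: time_vfields_def K_derivation_def)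
  have wadd: "\<omega> (Y + Y') = \<omega> Y + \<omega> Y'" if "Y \<in> ?V" "Y' \<in> ?V" for Y Y'
    using w that by (simp add: one_forms_def)
  have wsc: "\<omega> (\<lambda>g. f * Y g) = f * \<omega> Y" if "Y \<in> ?V" for f Y
    using w that by (simp add: one_forms_def)
  have Vadd: "Y + Y' \<in> ?V" if Y: "Y \<in> ?V" "Y' \<in> ?V" for Y Y'
  proof -
    have d: "K_derivation Y" "K_derivation Y'" using Y by (auto simp: time_vfields_def)
    have "K_derivation (Y + Y')"
      by (rule K_derivationI)
         (simp_all add: K_derivationD(1,3)[OF d(1)] K_derivationD(1,3)[OF d(2)]
            K_derivation_mconst[OF d(1)] K_derivation_mconst[OF d(2)] algebra_simps)
    then show ?thesis using Y by (simp add: time_vfields_def)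
  qed
  have Vsc: "(\<lambda>g. f * Y g) \<in> ?V" if Y: "Y \<in> ?V" for f Y
  proof -
    have d: "K_derivation Y" using Y by (auto simp: time_vfields_def)
    have "K_derivation (\<lambda>g. f * Y g)"
      by (rule K_derivationI)
         (simp_all add: K_derivationD(1,3)[OF d] K_derivation_mconst[OF d] algebra_simps)
    then show ?thesis using Y by (simp add: time_vfields_def)
  qed
  have br: "lie_bracket Z Y \<in> ?V" if "Y \<in> ?V" for Y
    using Z that by (rule lie_bracket_in_time_vfields)
  have "lie_form ?V Z \<omega> (Y + Y') = lie_form ?V Z \<omega> Y + lie_form ?V Z \<omega> Y'"
    if Y: "Y \<in> ?V" "Y' \<in> ?V" for Y Y'
  proof -
    have "lie_bracket Z (Y + Y') = lie_bracket Z Y + lie_bracket Z Y'"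
      by (simp add: lie_bracket_def fun_eq_iff dZ)
    then show ?thesis
      using Y by (simp add: lie_form_def Vadd wadd br dZ)
  qed
  moreover have "lie_form ?V Z \<omega> (\<lambda>g. f * Y g) = f * lie_form ?V Z \<omega> Y" if Y: "Y \<in> ?V" for f Y
  proof -
    have "lie_bracket Z (\<lambda>g. f * Y g) = (\<lambda>g. Z f * Y g) + (\<lambda>g. f * lie_bracket Z Y g)"
      by (simp add: lie_bracket_def fun_eq_iff dZ algebra_simps)
    then show ?thesis
      using Y by (simp add: lie_form_def Vsc wadd wsc br dZ) (simp add: algebra_simps)
  qed
  ultimately show ?thesis
    by (simp add: one_forms_def lie_form_def)
qed

abbreviation formal_diffeo :: "(('a::comm_ring_1, 'n::finite) mfps \<Rightarrow> ('a, 'n) mfps) \<Rightarrow> bool" where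
  "formal_diffeo \<equiv> K_algebra_automorphism"

definition formal_isotopy ::
    "(('a::comm_ring_1, 'n::finite option) mfps \<Rightarrow> ('a, 'n option) mfps) \<Rightarrow> bool" where
  "formal_isotopy \<phi> \<longleftrightarrow> K_algebra_automorphism \<phi> \<and> \<phi> tvar = tvar"

text \<open>The coefficient of \<open>x\<^sup>\<alpha>\<close>, as a power series in \<open>t\<close>.\<close>

definition xcoeff :: "('a, 'n option) mfps \<Rightarrow> ('n \<Rightarrow> nat) \<Rightarrow> 'a fps" where
  "xcoeff f \<alpha> = Abs_fps (\<lambda>k. mcoeff f (case_option k \<alpha>))"

text \<open>The inclusion of \<open>K[[x]]\<close> into \<open>K[[t,x]]\<close> and the substitution \<open>t = 0\<close>.\<close>

definition embed :: "('a::zero, 'n) mfps \<Rightarrow> ('a, 'n option) mfps" where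
  "embed f = Abs_mfps (\<lambda>m. if m None = 0 then mcoeff f (m \<circ> Some) else 0)"

definition at_time_zero :: "('a, 'n option) mfps \<Rightarrow> ('a, 'n) mfps" where
  "at_time_zero f = Abs_mfps (\<lambda>\<alpha>. fps_nth (xcoeff f \<alpha>) 0)"

definition is_flow ::
    "('a::comm_ring_1, 'n::finite option) mfps vfield \<Rightarrow>
     (('a, 'n option) mfps \<Rightarrow> ('a, 'n option) mfps) \<Rightarrow> bool" where
  "is_flow X \<phi> \<longleftrightarrow> formal_isotopy \<phi> \<and>
     (\<forall>f :: ('a, 'n) mfps.
        at_time_zero (\<phi> (embed f)) = f \<and>
        pderiv_var None (\<phi> (embed f)) = \<phi> (X (embed f)))"

section \<open>Evaluative objects\<close>

definition evaluative :: "('a::field_char_0, 'n option) mfps \<Rightarrow> bool" where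
  "evaluative f \<longleftrightarrow> (\<forall>\<alpha>. \<exists>p. xcoeff f \<alpha> = fps_of_poly p)"

definition xcoeff_poly :: "('a::field_char_0, 'n option) mfps \<Rightarrow> ('n \<Rightarrow> nat) \<Rightarrow> 'a poly" where
  "xcoeff_poly f \<alpha> = (THE p. xcoeff f \<alpha> = fps_of_poly p)"

definition eval_at :: "'a::field_char_0 \<Rightarrow> ('a, 'n option) mfps \<Rightarrow> ('a, 'n) mfps" where
  "eval_at \<tau> f = Abs_mfps (\<lambda>\<alpha>. poly (xcoeff_poly f \<alpha>) \<tau>)"

text \<open>Components with upper indices \<open>is\<close> and lower indices \<open>js\<close>.\<close>

definition time_component ::
    "('a::field_char_0, 'n::finite option) mfps tensor \<Rightarrow> 'n list \<Rightarrow> 'n list \<Rightarrow> ('a, 'n option) mfps"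
  where
  "time_component A is js =
     A (map (\<lambda>i. coord_form time_vfields (mvar (Some i))) is) (map (\<lambda>j. pderiv_var (Some j)) js)"

definition evaluative_tensor ::
    "nat \<Rightarrow> nat \<Rightarrow> ('a::field_char_0, 'n::finite option) mfps tensor \<Rightarrow> bool" where
  "evaluative_tensor r s A \<longleftrightarrow>
     (\<forall>is js. length is = r \<and> length js = s \<longrightarrow> evaluative (time_component A is js))"

text \<open>The tensor field of type \<open>(r,s)\<close> with given components: the sum of the multiples
  \<open>c is js\<close> of the tensor products of the \<open>\<partial>/\<partial>x\<^sup>i\<close>'s and \<open>dx\<^sup>j\<close>'s.\<close>

definition tensor_of_components ::
    "nat \<Rightarrow> nat \<Rightarrow> ('n list \<Rightarrow> 'n list \<Rightarrow> ('a::field_char_0, 'n::finite) mfps) \<Rightarrow>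
     ('a, 'n) mfps tensor" where
  "tensor_of_components r s c = (\<lambda>\<omega>s Ys.
     if tensor_args formal_vfields r s \<omega>s Ys then
       (\<Sum>is | length is = r. \<Sum>js | length js = s.
          c is js * (\<Prod>k<r. (\<omega>s ! k) (pderiv_var (is ! k)))
                  * (\<Prod>k<s. coord_form formal_vfields (mvar (js ! k)) (Ys ! k)))
     else 0)"

definition tensor_at ::
    "nat \<Rightarrow> nat \<Rightarrow> 'a::field_char_0 \<Rightarrow> ('a, 'n::finite option) mfps tensor \<Rightarrow> ('a, 'n) mfps tensor" where
  "tensor_at r s \<tau> A =
     tensor_of_components r s (\<lambda>is js. eval_at \<tau> (time_component A is js))"

text \<open>In the Jacobian matrix, the value at \<open>x = 0\<close> of a series is its coefficient of \<open>x\<^sup>0\<close>, which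
  lies in \<open>K[t]\<close> for evaluative series.\<close>

definition jacobian_at_origin ::
    "(('a::field_char_0, 'n::finite option) mfps \<Rightarrow> ('a, 'n option) mfps) \<Rightarrow> 'a poly ^ 'n ^ 'n" where
  "jacobian_at_origin \<phi> =
     (\<chi> i j. xcoeff_poly (pderiv_var (Some j) (\<phi> (mvar (Some i)))) 0)"

definition evaluative_isotopy ::
    "(('a::field_char_0, 'n::finite option) mfps \<Rightarrow> ('a, 'n option) mfps) \<Rightarrow> bool" where
  "evaluative_isotopy \<phi> \<longleftrightarrow> formal_isotopy \<phi> \<and>
     (\<forall>i. evaluative (\<phi> (mvar (Some i))) \<and> xcoeff (\<phi> (mvar (Some i))) 0 = 0) \<and>
     invertible (jacobian_at_origin \<phi>)"

definition isotopy_at ::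
    "'a::field_char_0 \<Rightarrow> (('a, 'n::finite option) mfps \<Rightarrow> ('a, 'n option) mfps) \<Rightarrow>
     (('a, 'n) mfps \<Rightarrow> ('a, 'n) mfps)" where
  "isotopy_at \<tau> \<phi> =
     (THE \<psi>. formal_diffeo \<psi> \<and> (\<forall>i. \<psi> (mvar i) = eval_at \<tau> (\<phi> (mvar (Some i)))))"

end

theory Submission
  imports Defs
begin

text \<open>The tensor field \<open>\<phi>\<^sup>* A\<close> does not depend on \<open>t\<close>: the flow equation says that
  \<open>\<phi>\<^bsup>-1\<^esup> \<circ> \<partial>/\<partial>t \<circ> \<phi> = \<partial>/\<partial>t + X\<close> as derivations of \<open>K[[t,x]]\<close> (\<open>flow_conjugates_time_derivative\<close>), so
  \<open>\<partial>/\<partial>t\<close> of a component of \<open>\<phi>\<^sup>* A\<close> is \<open>\<phi>\<close> applied to a value of the Lie derivative of \<open>A\<close> along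
  \<open>\<partial>/\<partial>t + X\<close>, which vanishes (\<open>moving_component_constant\<close>). Evaluating these components at \<open>t = \<tau>\<close>
  gives the components of the pullback of \<open>A\<^sub>\<tau>\<close> by \<open>\<phi>\<^sub>\<tau>\<close> (\<open>pullback_slice_tensor_at\<close>). Being constant, they are
  the same for \<open>\<tau>\<close> and for \<open>0\<close>, and \<open>\<phi>\<^sub>0\<close> is the identity.

  The remaining work is to make sense of evaluation along \<open>\<phi>\<close>: \<open>\<phi>\<close> and \<open>\<phi>\<^bsup>-1\<^esup>\<close> preserve evaluative series,
  and \<open>\<phi>\<close> descends at each \<open>\<tau>\<close> to an automorphism of \<open>K[[x]]\<close>. All of this is contained in one statement,
  \<open>coeffs_in_image_iff\<close>: for every \<open>K[t]\<close>-submodule \<open>S\<close> of \<open>K[[t]]\<close>, the \<open>x\<close>-coefficients of \<open>h\<close> lie in \<open>S\<close>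
  if and only if those of \<open>\<phi> h\<close> do. It is proved by induction on the degree, since in characteristic
  zero a series is determined by its value at \<open>x = 0\<close> and its partial derivatives, and the chain rule
  expresses the partial derivatives of \<open>\<phi> h\<close> through a Jacobian matrix that is invertible at the origin.\<close>

section \<open>Derivations and automorphisms of a power series ring\<close>

declare plus_mfps.rep_eq [simp] minus_mfps.rep_eq [simp] uminus_mfps.rep_eq [simp]
  zero_mfps.rep_eq [simp]

lemma mcoeff_sum [simp]:
  "mcoeff (sum f I) m = (\<Sum>i\<in>I. mcoeff (f i :: ('a::comm_ring_1, 'v::finite) mfps) m)"
  by (induction I rule: infinite_finite_induct) auto

lemma mcoeff_mvar_mult:
  fixes f :: "('a::comm_ring_1, 'v::finite) mfps"
  shows "mcoeff (mvar v * f) m = (if m v = 0 then 0 else mcoeff f (m - unit_exp v))"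
proof -
  let ?g = "\<lambda>(a, b). (if a = unit_exp v then 1 else 0) * mcoeff f b"
  have eq: "mcoeff (mvar v * f) m = sum ?g (splits m)"
    by (simp add: times_mfps.rep_eq mvar_def)
  have zero: "?g p = 0" if "p \<in> splits m" "p \<noteq> (unit_exp v, m - unit_exp v)" for p
  proof (cases "fst p = unit_exp v")
    case True
    with that(1) have "snd p = m - unit_exp v"
      by (auto simp: splits_def fun_eq_iff) (metis add_diff_cancel_left')
    then show ?thesis using True that(2) by (cases p) simp
  qed (cases p; simp)
  show ?thesis
  proof (cases "m v = 0")
    case True
    have "fst p \<noteq> unit_exp v" if "p \<in> splits m" for p
    proof
      assume "fst p = unit_exp v"
      then have "(unit_exp v + snd p) v = m v" using that by (auto simp: splits_def)
      then show False using True by (simp add: unit_exp_def)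
    qed
    then have "?g p = 0" if "p \<in> splits m" for p
      using that by (cases p) fastforce
    then show ?thesis unfolding eq using True by (simp add: sum.neutral)
  next
    case False
    then have "(unit_exp v, m - unit_exp v) \<in> splits m"
      by (auto simp: splits_def unit_exp_def fun_eq_iff)
    then have "sum ?g (splits m) = sum ?g {(unit_exp v, m - unit_exp v)}"
      using zero by (intro sum.mono_neutral_right) auto
    then show ?thesis unfolding eq using False by simp
  qed
qed

lemma exponent_sum_decrease:
  fixes m :: "'v::finite \<Rightarrow> nat"
  assumes "m v \<noteq> 0"
  shows "sum (m - unit_exp v) UNIV < sum m UNIV"
  by (rule sum_strict_mono_ex1) (use assms in \<open>auto simp: unit_exp_def intro!: bexI[of _ v]\<close>)

lemma exponent_minus_plus:
  fixes m :: "'v::finite \<Rightarrow> nat"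
  assumes "m v \<noteq> 0"
  shows "m - unit_exp v + unit_exp v = m"
  using assms by (auto simp: unit_exp_def fun_eq_iff)

lemma exponent_nonzero_obtain:
  fixes m :: "'v \<Rightarrow> nat"
  assumes "m \<noteq> 0"
  obtains v where "m v \<noteq> 0"
  using assms by (auto simp: fun_eq_iff)

text \<open>Each monomial other than \<open>1\<close> is assigned to one variable dividing it. The decomposition lets
  identities for derivations and automorphisms be proved coefficient by coefficient, by induction
  on the degree; this takes the place of continuity of these maps.\<close>

lemma mfps_decompose:
  fixes f :: "('a::comm_ring_1, 'v::finite) mfps"
  obtains g where "f = mconst (mcoeff f 0) + (\<Sum>v\<in>UNIV. mvar v * g v)"
proof -
  define c where "c m = (SOME v. m v \<noteq> 0)" for m :: "'v \<Rightarrow> nat"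
  have c: "m (c m) \<noteq> 0" if "m \<noteq> 0" for m
    unfolding c_def using that by (metis (mono_tags) exponent_nonzero_obtain someI_ex)
  define g where "g v = Abs_mfps (\<lambda>m. if c (m + unit_exp v) = v then mcoeff f (m + unit_exp v) else 0)"
    for v
  have "f = mconst (mcoeff f 0) + (\<Sum>v\<in>UNIV. mvar v * g v)"
  proof (rule mfps_eqI)
    fix m
    have "(\<Sum>v\<in>UNIV. mcoeff (mvar v * g v) m) =
        (\<Sum>v\<in>UNIV. if v = c m then (if m = 0 then 0 else mcoeff f m) else 0)"
    proof (rule sum.cong[OF refl])
      fix v
      show "mcoeff (mvar v * g v) m = (if v = c m then (if m = 0 then 0 else mcoeff f m) else 0)"
        using c[of m] exponent_minus_plus[of m v]
        by (auto simp: mcoeff_mvar_mult g_def)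
    qed
    then show "mcoeff f m = mcoeff (mconst (mcoeff f 0) + (\<Sum>v\<in>UNIV. mvar v * g v)) m"
      by (simp add: mconst_def)
  qed
  then show thesis by (rule that)
qed

lemma K_derivation_sum:
  assumes "K_derivation D"
  shows "D (sum f I) = (\<Sum>i\<in>I. D (f i))"
  by (induction I rule: infinite_finite_induct)
     (simp_all add: K_derivation_0_1[OF assms] K_derivationD(1)[OF assms])

lemma K_derivation_add:
  assumes "K_derivation D" "K_derivation E"
  shows "K_derivation (D + E)"
  by (rule K_derivationI)
     (simp_all add: assms[THEN K_derivationD(1)] assms[THEN K_derivationD(3)]
        assms[THEN K_derivation_mconst] algebra_simps)

lemma K_derivation_scale:
  assumes "K_derivation D"
  shows "K_derivation (\<lambda>g. f * D g)"
  by (rule K_derivationI)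
     (simp_all add: K_derivationD(1,3)[OF assms] K_derivation_mconst[OF assms] algebra_simps)

text \<open>For \<open>f = c + \<Sum> x\<^sup>v g\<^sub>v\<close> the value \<open>D f\<close> is \<open>\<Sum> x\<^sup>v D g\<^sub>v\<close>, whose coefficients of a given degree
  only involve coefficients of the \<open>D g\<^sub>v\<close> of smaller degree.\<close>

lemma K_derivation_eq_zero:
  fixes D :: "('a::comm_ring_1, 'v::finite) mfps \<Rightarrow> ('a, 'v) mfps"
  assumes D: "K_derivation D" and zero: "\<And>v. D (mvar v) = 0"
  shows "D f = 0"
proof -
  have "mcoeff (D f) m = 0" for m
  proof (induction m arbitrary: f rule: measure_induct_rule[where f = "\<lambda>m. sum m UNIV"])
    case (less m)
    obtain g where g: "f = mconst (mcoeff f 0) + (\<Sum>v\<in>UNIV. mvar v * g v)"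
      by (rule mfps_decompose)
    have "D f = (\<Sum>v\<in>UNIV. mvar v * D (g v))"
      by (subst g) (simp add: K_derivationD[OF D] K_derivation_mconst[OF D] K_derivation_sum[OF D] zero)
    moreover have "mcoeff (mvar v * D (g v)) m = 0" for v
      by (metis less.IH exponent_sum_decrease mcoeff_mvar_mult)
    ultimately show ?case by simp
  qed
  then show ?thesis by (intro mfps_eqI) simp
qed

lemma K_derivation_eqI:
  fixes D E :: "('a::comm_ring_1, 'v::finite) mfps \<Rightarrow> ('a, 'v) mfps"
  assumes D: "K_derivation D" and E: "K_derivation E" and eq: "\<And>v. D (mvar v) = E (mvar v)"
  shows "D = E"
proof
  fix f
  have "K_derivation (D + (\<lambda>g. - 1 * E g))"
    by (intro K_derivation_add K_derivation_scale D E)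
  from K_derivation_eq_zero[OF this, of f] show "D f = E f"
    by (simp add: eq)
qed

lemma K_derivation_expand:
  fixes D :: "('a::comm_ring_1, 'v::finite) mfps \<Rightarrow> ('a, 'v) mfps"
  assumes D: "K_derivation D"
  shows "D f = (\<Sum>v\<in>UNIV. D (mvar v) * pderiv_var v f)"
proof -
  let ?E = "\<lambda>f. \<Sum>v\<in>UNIV. D (mvar v) * pderiv_var v f"
  note p = K_derivationD(1,3)[OF K_derivation_pderiv_var]
  have "K_derivation ?E"
  proof (rule K_derivationI)
    show "?E (f + g) = ?E f + ?E g" for f g
      by (simp add: p distrib_left sum.distrib)
    show "?E (f * g) = ?E f * g + f * ?E g" for f g
      by (simp add: p distrib_left sum.distrib sum_distrib_left sum_distrib_right mult_ac)
    show "?E (mconst c) = 0" for c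
      by (simp add: K_derivation_mconst[OF K_derivation_pderiv_var])
  qed
  then have "D = ?E"
    by (rule K_derivation_eqI[OF D])
       (simp add: pderiv_var_mvar if_distrib[of "\<lambda>x. _ * x"] cong: if_cong)
  then show ?thesis by (rule fun_cong)
qed

context
  fixes \<phi> :: "('a::comm_ring_1, 'v::finite) mfps \<Rightarrow> ('a, 'v) mfps"
  assumes aut: "K_algebra_automorphism \<phi>"
begin

lemma automorphism_bij: "bij \<phi>"
  and automorphism_1: "\<phi> 1 = 1"
  and automorphism_add: "\<phi> (f + g) = \<phi> f + \<phi> g"
  and automorphism_mult: "\<phi> (f * g) = \<phi> f * \<phi> g"
  and automorphism_scale: "\<phi> (mconst c * f) = mconst c * \<phi> f"
  using aut by (auto simp: K_algebra_automorphism_def)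

lemma automorphism_inv: "\<phi> (inv \<phi> f) = f" "inv \<phi> (\<phi> f) = f"
  using automorphism_bij by (simp_all add: bij_is_surj surj_f_inv_f bij_is_inj inv_f_f)

lemma automorphism_0: "\<phi> 0 = 0"
  using automorphism_add[of 0 0] by simp

lemma automorphism_mconst: "\<phi> (mconst c) = mconst c"
  using automorphism_scale[of c 1] by (simp add: automorphism_1)

lemma automorphism_sum: "\<phi> (sum f I) = (\<Sum>i\<in>I. \<phi> (f i))"
  by (induction I rule: infinite_finite_induct) (simp_all add: automorphism_0 automorphism_add)

lemma automorphism_prod: "\<phi> (prod f I) = (\<Prod>i\<in>I. \<phi> (f i))"
  by (induction I rule: infinite_finite_induct) (simp_all add: automorphism_1 automorphism_mult)

lemma automorphism_inverse: "K_algebra_automorphism (inv \<phi>)"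
proof -
  have inj: "f = g" if "\<phi> f = \<phi> g" for f g
    using that automorphism_bij by (meson bij_is_inj injD)
  show ?thesis
    unfolding K_algebra_automorphism_def
    by (intro conjI allI bij_imp_bij_inv automorphism_bij; rule inj)
       (simp_all add: automorphism_inv automorphism_1 automorphism_add automorphism_mult
         automorphism_mconst)
qed

lemma inv_inv_automorphism: "inv (inv \<phi>) = \<phi>"
  by (rule inv_inv_eq[OF automorphism_bij])

end

lemma K_derivation_conjugate:
  assumes \<phi>: "K_algebra_automorphism \<phi>" and D: "K_derivation D"
  shows "K_derivation (\<lambda>f. inv \<phi> (D (\<phi> f)))"
  by (rule K_derivationI)
     (simp_all add: automorphism_add[OF \<phi>] automorphism_mult[OF \<phi>] automorphism_mconst[OF \<phi>]
       K_derivationD(1,3)[OF D] K_derivation_mconst[OF D] automorphism_inv[OF \<phi>]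
       automorphism_add[OF automorphism_inverse[OF \<phi>]]
       automorphism_mult[OF automorphism_inverse[OF \<phi>]]
       automorphism_0[OF automorphism_inverse[OF \<phi>]])

text \<open>This is the coordinate expansion of the derivation \<open>\<phi>\<^bsup>-1\<^esup> \<circ> D \<circ> \<phi>\<close>, with \<open>\<phi>\<close> applied to both sides.\<close>

lemma chain_rule:
  assumes \<phi>: "K_algebra_automorphism \<phi>" and D: "K_derivation D"
  shows "D (\<phi> f) = (\<Sum>v\<in>UNIV. D (\<phi> (mvar v)) * \<phi> (pderiv_var v f))"
proof -
  have "D (\<phi> f) = \<phi> (inv \<phi> (D (\<phi> f)))"
    by (simp add: automorphism_inv[OF \<phi>])
  also have "\<dots> = \<phi> (\<Sum>v\<in>UNIV. inv \<phi> (D (\<phi> (mvar v))) * pderiv_var v f)"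
    by (subst K_derivation_expand[OF K_derivation_conjugate[OF \<phi> D]]) (rule refl)
  finally show ?thesis
    by (simp add: automorphism_sum[OF \<phi>] automorphism_mult[OF \<phi>] automorphism_inv[OF \<phi>])
qed

text \<open>The automorphism \<open>\<chi> = \<psi>\<^bsup>-1\<^esup> \<circ> \<phi>\<close> fixes the variables; the induction is that of
  \<open>K_derivation_eq_zero\<close>.\<close>

lemma automorphism_eqI:
  fixes \<phi> \<psi> :: "('a::comm_ring_1, 'v::finite) mfps \<Rightarrow> ('a, 'v) mfps"
  assumes \<phi>: "K_algebra_automorphism \<phi>" and \<psi>: "K_algebra_automorphism \<psi>"
    and eq: "\<And>v. \<phi> (mvar v) = \<psi> (mvar v)"
  shows "\<phi> = \<psi>"
proof
  fix f
  note inv\<psi> = automorphism_inverse[OF \<psi>]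
  let ?\<chi> = "\<lambda>f. inv \<psi> (\<phi> f)"
  have var: "?\<chi> (mvar v) = mvar v" for v
    by (simp add: eq automorphism_inv[OF \<psi>])
  have "mcoeff (?\<chi> f) m = mcoeff f m" for m
  proof (induction m arbitrary: f rule: measure_induct_rule[where f = "\<lambda>m. sum m UNIV"])
    case (less m)
    obtain g where g: "f = mconst (mcoeff f 0) + (\<Sum>v\<in>UNIV. mvar v * g v)"
      by (rule mfps_decompose)
    have \<chi>: "?\<chi> f = mconst (mcoeff f 0) + (\<Sum>v\<in>UNIV. mvar v * ?\<chi> (g v))"
      by (subst g) (simp add: automorphism_add[OF \<phi>] automorphism_mult[OF \<phi>]
        automorphism_mconst[OF \<phi>] automorphism_sum[OF \<phi>] automorphism_add[OF inv\<psi>]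
        automorphism_mult[OF inv\<psi>] automorphism_mconst[OF inv\<psi>] automorphism_sum[OF inv\<psi>] var)
    have "mcoeff (mvar v * ?\<chi> (g v)) m = mcoeff (mvar v * g v) m" for v
      unfolding mcoeff_mvar_mult by (metis less.IH exponent_sum_decrease)
    then have "mcoeff (?\<chi> f) m = mcoeff (mconst (mcoeff f 0) + (\<Sum>v\<in>UNIV. mvar v * g v)) m"
      unfolding \<chi> by simp
    then show ?case using g by simp
  qed
  then have "?\<chi> f = f" by (intro mfps_eqI)
  then show "\<phi> f = \<psi> f" by (metis automorphism_inv(1)[OF \<psi>])
qed

section \<open>Coefficients in \<open>K[[t]]\<close> and evaluation in time\<close>

lemma xcoeff_add: "xcoeff (f + g) \<alpha> = xcoeff f \<alpha> + xcoeff (g :: ('a::comm_ring_1, 'n::finite option) mfps) \<alpha>"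
  by (rule fps_ext) (simp add: xcoeff_def)

lemma xcoeff_0: "xcoeff (0 :: ('a::comm_ring_1, 'n::finite option) mfps) \<alpha> = 0"
  by (rule fps_ext) (simp add: xcoeff_def)

lemma xcoeff_sum:
  "xcoeff (sum f I) \<alpha> = (\<Sum>i\<in>I. xcoeff (f i :: ('a::comm_ring_1, 'n::finite option) mfps) \<alpha>)"
  by (induction I rule: infinite_finite_induct) (auto simp: xcoeff_add xcoeff_0)

text \<open>An exponent vector in \<open>(t,x)\<close> splits by splitting the \<open>x\<close>-part and the \<open>t\<close>-part independently, which
  makes \<open>xcoeff\<close> turn products into convolutions.\<close>

lemma splits_case_option:
  "splits (case_option k \<alpha>) =
     (\<lambda>((\<beta>, \<gamma>), i). (case_option i \<beta>, case_option (k - i) \<gamma>)) ` (splits \<alpha> \<times> {0..k})"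
proof (intro equalityI subsetI)
  fix p assume "p \<in> splits (case_option k \<alpha>)"
  then obtain a b where p: "p = (a, b)" "a + b = case_option k \<alpha>" by (auto simp: splits_def)
  have s: "a w + b w = (case w of None \<Rightarrow> k | Some v \<Rightarrow> \<alpha> v)" for w
    using p(2) by (metis plus_fun_apply)
  have "a = case_option (a None) (a \<circ> Some)" "b = case_option (k - a None) (b \<circ> Some)"
    using s[of None] by (auto simp: fun_eq_iff split: option.split)
  moreover have "(a \<circ> Some, b \<circ> Some) \<in> splits \<alpha>"
    using s[of "Some v" for v] by (auto simp: splits_def fun_eq_iff)
  moreover have "a None \<in> {0..k}" using s[of None] by simp
  ultimately show "p \<in> (\<lambda>((\<beta>, \<gamma>), i). (case_option i \<beta>, case_option (k - i) \<gamma>)) ` (splits \<alpha> \<times> {0..k})"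
    unfolding p(1) by (intro image_eqI[of _ _ "((a \<circ> Some, b \<circ> Some), a None)"]) auto
qed (auto simp: splits_def fun_eq_iff split: option.split)

lemma xcoeff_mult:
  fixes f g :: "('a::comm_ring_1, 'n::finite option) mfps"
  shows "xcoeff (f * g) \<alpha> = (\<Sum>(\<beta>, \<gamma>)\<in>splits \<alpha>. xcoeff f \<beta> * xcoeff g \<gamma>)"
proof (rule fps_ext)
  fix k
  let ?h = "\<lambda>((\<beta>, \<gamma>), i). (case_option i \<beta>, case_option (k - i) \<gamma>) :: ('n option \<Rightarrow> nat) \<times> ('n option \<Rightarrow> nat)"
  have inj: "inj_on ?h (splits \<alpha> \<times> {0..k})"
    by (rule inj_onI) (auto simp: fun_eq_iff split: option.splits prod.splits)
  have "fps_nth (xcoeff (f * g) \<alpha>) k =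
      (\<Sum>q\<in>splits \<alpha> \<times> {0..k}. case ?h q of (a, b) \<Rightarrow> mcoeff f a * mcoeff g b)"
    by (simp add: xcoeff_def times_mfps.rep_eq splits_case_option sum.reindex[OF inj] o_def)
  also have "\<dots> = (\<Sum>p\<in>splits \<alpha>. \<Sum>i=0..k.
      mcoeff f (case_option i (fst p)) * mcoeff g (case_option (k - i) (snd p)))"
    by (simp add: sum.cartesian_product case_prod_unfold)
  finally show "fps_nth (xcoeff (f * g) \<alpha>) k =
      fps_nth (\<Sum>(\<beta>, \<gamma>)\<in>splits \<alpha>. xcoeff f \<beta> * xcoeff g \<gamma>) k"
    by (simp add: xcoeff_def fps_sum_nth fps_mult_nth case_prod_unfold)
qed

lemma splits_zero: "splits (0 :: 'v \<Rightarrow> nat) = {(0, 0)}"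
  by (auto simp: splits_def fun_eq_iff)

lemma xcoeff_mult_0:
  fixes f g :: "('a::comm_ring_1, 'n::finite option) mfps"
  shows "xcoeff (f * g) 0 = xcoeff f 0 * xcoeff g 0"
  by (simp add: xcoeff_mult splits_zero)

lemma xcoeff_pderiv_Some:
  fixes f :: "('a::comm_ring_1, 'n::finite option) mfps"
  shows "xcoeff (pderiv_var (Some j) f) \<alpha> = of_nat (\<alpha> j + 1) * xcoeff f (\<alpha> + unit_exp j)"
proof (rule fps_ext)
  fix k
  have "case_option k \<alpha> + unit_exp (Some j) = case_option k (\<alpha> + unit_exp j)"
    by (auto simp: fun_eq_iff unit_exp_def split: option.split)
  moreover have "(of_nat (\<alpha> j + 1) :: 'a fps) = fps_const (of_nat (\<alpha> j + 1))"
    by (rule fps_of_nat[symmetric])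
  ultimately show "fps_nth (xcoeff (pderiv_var (Some j) f) \<alpha>) k =
      fps_nth (of_nat (\<alpha> j + 1) * xcoeff f (\<alpha> + unit_exp j)) k"
    by (simp add: xcoeff_def pderiv_var_def)
qed

lemma xcoeff_pderiv_None:
  fixes f :: "('a::comm_ring_1, 'n::finite option) mfps"
  shows "xcoeff (pderiv_var None f) \<alpha> = fps_deriv (xcoeff f \<alpha>)"
proof (rule fps_ext)
  fix k
  have "case_option k \<alpha> + unit_exp None = case_option (Suc k) \<alpha>"
    by (auto simp: fun_eq_iff unit_exp_def split: option.split)
  then show "fps_nth (xcoeff (pderiv_var None f) \<alpha>) k = fps_nth (fps_deriv (xcoeff f \<alpha>)) k"
    by (simp add: xcoeff_def pderiv_var_def)
qed

lemma xcoeff_tvar_mult: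
  fixes f :: "('a::comm_ring_1, 'n::finite option) mfps"
  shows "xcoeff (tvar * f) \<alpha> = fps_X * xcoeff f \<alpha>"
proof (rule fps_ext)
  fix k
  have "case_option k \<alpha> - unit_exp None = case_option (k - 1) \<alpha>"
    by (auto simp: fun_eq_iff unit_exp_def split: option.split)
  then show "fps_nth (xcoeff (tvar * f) \<alpha>) k = fps_nth (fps_X * xcoeff f \<alpha>) k"
    by (simp add: xcoeff_def mcoeff_mvar_mult)
qed

lemma xcoeff_mvar_Some: "xcoeff (mvar (Some i)) \<alpha> = (if \<alpha> = unit_exp i then 1 else 0)"
proof (rule fps_ext)
  fix k
  have "case_option k \<alpha> = unit_exp (Some i) \<longleftrightarrow> k = 0 \<and> \<alpha> = unit_exp i"
    by (auto simp: unit_exp_def fun_eq_iff split: option.split)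
  then show "fps_nth (xcoeff (mvar (Some i)) \<alpha>) k = fps_nth (if \<alpha> = unit_exp i then 1 else 0) k"
    by (simp add: xcoeff_def mvar_def)
qed

lemma xcoeff_mconst: "xcoeff (mconst c) \<alpha> = (if \<alpha> = 0 then fps_const c else 0)"
  by (rule fps_ext) (auto simp: xcoeff_def mconst_def fun_eq_iff split: option.splits)

lemma xcoeff_embed: "xcoeff (embed f) \<alpha> = fps_const (mcoeff f \<alpha>)"
  by (rule fps_ext) (auto simp: xcoeff_def embed_def o_def)

lemma xcoeff_eqI:
  assumes eq: "\<And>\<alpha>. xcoeff f \<alpha> = xcoeff g \<alpha>"
  shows "f = g"
proof (rule mfps_eqI)
  fix m :: "'a option \<Rightarrow> nat"
  have m: "case_option (m None) (m \<circ> Some) = m"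
    by (auto simp: fun_eq_iff split: option.split)
  show "mcoeff f m = mcoeff g m"
    using arg_cong[OF eq[of "m \<circ> Some"], of "\<lambda>p. fps_nth p (m None)"] by (simp add: xcoeff_def m)
qed

lemma mcoeff_mvar: "mcoeff (mvar v) m = (if m = unit_exp v then 1 else 0)"
  by (simp add: mvar_def)

lemma embed_mvar: "embed (mvar i) = (mvar (Some i) :: ('a::comm_ring_1, 'n::finite option) mfps)"
  by (rule xcoeff_eqI) (simp add: xcoeff_embed xcoeff_mvar_Some mcoeff_mvar)

section \<open>Submodules of \<open>K[[t]]\<close> over \<open>K[t]\<close>\<close>

text \<open>Two instances matter: \<open>K[t]\<close> itself, whose series are the evaluative ones, and the ideal
  \<open>(t - \<tau>) K[t]\<close>, whose series are the evaluative ones that vanish at \<open>t = \<tau>\<close>. Treating an arbitrary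
  submodule gives preservation of evaluativity and compatibility with evaluation by one argument.\<close>

definition poly_submodule :: "'a::field_char_0 fps set \<Rightarrow> bool" where
  "poly_submodule S \<longleftrightarrow> 0 \<in> S \<and> (\<forall>u\<in>S. \<forall>v\<in>S. u + v \<in> S) \<and> (\<forall>p. \<forall>u\<in>S. fps_of_poly p * u \<in> S)"

definition coeffs_in :: "'a fps set \<Rightarrow> ('a, 'n option) mfps \<Rightarrow> bool" where
  "coeffs_in S f \<longleftrightarrow> (\<forall>\<alpha>. xcoeff f \<alpha> \<in> S)"

definition poly_vanishing_at :: "'a::field_char_0 \<Rightarrow> 'a fps set" where
  "poly_vanishing_at \<tau> = {fps_of_poly p |p. poly p \<tau> = 0}"

lemma poly_submodule_polys: "poly_submodule (range fps_of_poly)"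
  unfolding poly_submodule_def
  by (auto simp flip: fps_of_poly_add fps_of_poly_mult intro: range_eqI[of _ _ 0])

lemma poly_submodule_vanishing: "poly_submodule (poly_vanishing_at \<tau>)"
proof -
  have "\<exists>r. fps_of_poly p + fps_of_poly q = fps_of_poly r \<and> poly r \<tau> = 0"
    if "poly p \<tau> = 0" "poly q \<tau> = 0" for p q
    using that by (intro exI[of _ "p + q"]) (simp add: fps_of_poly_add)
  moreover have "\<exists>r. fps_of_poly p * fps_of_poly q = fps_of_poly r \<and> poly r \<tau> = 0"
    if "poly q \<tau> = 0" for p q
    using that by (intro exI[of _ "p * q"]) (simp add: fps_of_poly_mult)
  moreover have "\<exists>r. 0 = fps_of_poly r \<and> poly r \<tau> = 0"
    by (intro exI[of _ 0]) simp
  ultimately show ?thesis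
    unfolding poly_submodule_def poly_vanishing_at_def by auto
qed

lemma evaluative_iff: "evaluative f \<longleftrightarrow> coeffs_in (range fps_of_poly) f"
  by (auto simp: evaluative_def coeffs_in_def)

context
  fixes S :: "'a::field_char_0 fps set"
  assumes S: "poly_submodule S"
begin

lemma submodule_0: "0 \<in> S" and submodule_add: "u \<in> S \<Longrightarrow> v \<in> S \<Longrightarrow> u + v \<in> S"
  and submodule_mult: "u \<in> S \<Longrightarrow> fps_of_poly p * u \<in> S"
  using S by (auto simp: poly_submodule_def)

lemma submodule_sum: "(\<And>i. i \<in> I \<Longrightarrow> f i \<in> S) \<Longrightarrow> sum f I \<in> S"
  by (induction I rule: infinite_finite_induct) (auto intro: submodule_0 submodule_add)

lemma submodule_of_nat_mult_iff:
  assumes "n \<noteq> 0"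
  shows "of_nat n * u \<in> S \<longleftrightarrow> u \<in> S"
proof
  have eq: "of_nat n = fps_of_poly [:of_nat n:]"
    by (simp add: fps_of_poly_const fps_of_nat)
  show "of_nat n * u \<in> S" if "u \<in> S"
    unfolding eq using that by (rule submodule_mult)
  assume "of_nat n * u \<in> S"
  from submodule_mult[OF this, of "[:1 / of_nat n:]"]
  have "fps_of_poly ([:1 / of_nat n:] * [:of_nat n:]) * u \<in> S"
    by (simp only: fps_of_poly_mult mult.assoc eq)
  moreover have "[:1 / of_nat n:] * [:of_nat n:] = (1 :: 'a poly)"
    using assms by (simp add: one_pCons)
  ultimately show "u \<in> S" by simp
qed

lemma coeffs_in_sum:
  fixes f :: "'i \<Rightarrow> ('a, 'n::finite option) mfps"
  shows "(\<And>i. i \<in> I \<Longrightarrow> coeffs_in S (f i)) \<Longrightarrow> coeffs_in S (sum f I)"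
  by (auto simp: coeffs_in_def xcoeff_sum intro: submodule_sum)

lemma coeffs_in_mult:
  fixes f g :: "('a, 'n::finite option) mfps"
  shows "evaluative f \<Longrightarrow> coeffs_in S g \<Longrightarrow> coeffs_in S (f * g)"
  unfolding coeffs_in_def xcoeff_mult evaluative_def
  by (intro allI submodule_sum) (metis case_prod_beta submodule_mult)

lemma coeffs_in_pderiv_Some:
  fixes f :: "('a, 'n::finite option) mfps"
  shows "coeffs_in S f \<Longrightarrow> coeffs_in S (pderiv_var (Some j) f)"
  by (simp add: coeffs_in_def xcoeff_pderiv_Some submodule_of_nat_mult_iff del: of_nat_add of_nat_Suc)

text \<open>Since nonzero integers are invertible, a coefficient of positive degree can be recovered from the
  coefficients of the partial derivatives; this is what makes inductions on the degree possible.\<close>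

lemma xcoeff_in_if_pderiv:
  fixes f :: "('a, 'n::finite option) mfps"
  assumes "\<alpha> j \<noteq> 0" and "xcoeff (pderiv_var (Some j) f) (\<alpha> - unit_exp j) \<in> S"
  shows "xcoeff f \<alpha> \<in> S"
  using assms(2)
  by (simp add: xcoeff_pderiv_Some exponent_minus_plus[of \<alpha> j, OF assms(1)]
      submodule_of_nat_mult_iff del: of_nat_add of_nat_Suc)

end

section \<open>Evaluation as a homomorphism\<close>

lemma xcoeff_poly_eqI: "xcoeff f \<alpha> = fps_of_poly p \<Longrightarrow> xcoeff_poly f \<alpha> = p"
  unfolding xcoeff_poly_def by (rule the_equality) (auto simp: fps_of_poly_eq_iff)

lemma fps_of_xcoeff_poly: "evaluative f \<Longrightarrow> fps_of_poly (xcoeff_poly f \<alpha>) = xcoeff f \<alpha>"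
  by (metis evaluative_def xcoeff_poly_eqI)

lemma mcoeff_eval_at: "mcoeff (eval_at \<tau> f) \<alpha> = poly (xcoeff_poly f \<alpha>) \<tau>"
  by (simp add: eval_at_def)

lemma evaluative_sum:
  fixes f :: "'i \<Rightarrow> ('a::field_char_0, 'n::finite option) mfps"
  shows "(\<And>i. i \<in> I \<Longrightarrow> evaluative (f i)) \<Longrightarrow> evaluative (sum f I)"
  unfolding evaluative_iff by (rule coeffs_in_sum[OF poly_submodule_polys])

lemma evaluative_add:
  fixes f g :: "('a::field_char_0, 'n::finite option) mfps"
  shows "evaluative f \<Longrightarrow> evaluative g \<Longrightarrow> evaluative (f + g)"
  unfolding evaluative_def by (metis xcoeff_add fps_of_poly_add)

lemma evaluative_mult:
  fixes f g :: "('a::field_char_0, 'n::finite option) mfps"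
  shows "evaluative f \<Longrightarrow> evaluative g \<Longrightarrow> evaluative (f * g)"
  using coeffs_in_mult[OF poly_submodule_polys] by (simp add: evaluative_iff)

lemma evaluative_mconst: "evaluative (mconst c)"
  by (auto simp: evaluative_def xcoeff_mconst fps_of_poly_const intro: exI[of _ "[:c:]"] exI[of _ 0])

lemma mconst_1: "mconst 1 = (1 :: ('a::comm_ring_1, 'v::finite) mfps)"
  by (rule mfps_eqI) (simp add: mconst_def one_mfps.rep_eq)

lemma evaluative_prod:
  fixes f :: "'i \<Rightarrow> ('a::field_char_0, 'n::finite option) mfps"
  shows "(\<And>i. i \<in> I \<Longrightarrow> evaluative (f i)) \<Longrightarrow> evaluative (prod f I)"
  using evaluative_mconst[of 1, where 'b = 'n]
  by (induction I rule: infinite_finite_induct) (auto simp: mconst_1 intro: evaluative_mult)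

lemma evaluative_mvar_Some: "evaluative (mvar (Some i))"
  by (auto simp: evaluative_def xcoeff_mvar_Some intro: exI[of _ 0] exI[of _ 1])

lemma evaluative_embed: "evaluative (embed f)"
  by (auto simp: evaluative_def xcoeff_embed fps_of_poly_const intro: exI[of _ "[:c:]" for c])

lemma evaluative_pderiv_Some:
  fixes f :: "('a::field_char_0, 'n::finite option) mfps"
  shows "evaluative f \<Longrightarrow> evaluative (pderiv_var (Some j) f)"
  unfolding evaluative_iff by (rule coeffs_in_pderiv_Some[OF poly_submodule_polys])

lemma eval_at_add:
  fixes f g :: "('a::field_char_0, 'n::finite option) mfps"
  assumes "evaluative f" "evaluative g"
  shows "eval_at \<tau> (f + g) = eval_at \<tau> f + eval_at \<tau> g"
proof (rule mfps_eqI)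
  fix \<alpha>
  have "xcoeff_poly (f + g) \<alpha> = xcoeff_poly f \<alpha> + xcoeff_poly g \<alpha>"
    by (rule xcoeff_poly_eqI) (simp add: xcoeff_add fps_of_poly_add fps_of_xcoeff_poly assms)
  then show "mcoeff (eval_at \<tau> (f + g)) \<alpha> = mcoeff (eval_at \<tau> f + eval_at \<tau> g) \<alpha>"
    by (simp add: mcoeff_eval_at)
qed

lemma eval_at_mult:
  fixes f g :: "('a::field_char_0, 'n::finite option) mfps"
  assumes "evaluative f" "evaluative g"
  shows "eval_at \<tau> (f * g) = eval_at \<tau> f * eval_at \<tau> g"
proof (rule mfps_eqI)
  fix \<alpha>
  have "xcoeff_poly (f * g) \<alpha> = (\<Sum>(\<beta>, \<gamma>)\<in>splits \<alpha>. xcoeff_poly f \<beta> * xcoeff_poly g \<gamma>)"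
    by (rule xcoeff_poly_eqI)
       (simp add: xcoeff_mult fps_of_poly_sum fps_of_poly_mult fps_of_xcoeff_poly assms
         case_prod_unfold)
  then show "mcoeff (eval_at \<tau> (f * g)) \<alpha> = mcoeff (eval_at \<tau> f * eval_at \<tau> g) \<alpha>"
    by (simp add: mcoeff_eval_at times_mfps.rep_eq poly_sum case_prod_unfold)
qed

lemma eval_at_mconst: "eval_at \<tau> (mconst c) = mconst c"
proof (rule mfps_eqI)
  fix \<alpha> :: "'b \<Rightarrow> nat"
  have "xcoeff_poly (mconst c) \<alpha> = (if \<alpha> = 0 then [:c:] else 0)"
    by (rule xcoeff_poly_eqI) (simp add: xcoeff_mconst fps_of_poly_const)
  then show "mcoeff (eval_at \<tau> (mconst c)) \<alpha> = mcoeff (mconst c) \<alpha>"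
    by (simp add: mcoeff_eval_at mconst_def)
qed

lemma eval_at_0: "eval_at \<tau> (0 :: ('a::field_char_0, 'n::finite option) mfps) = 0"
proof (rule mfps_eqI)
  fix \<alpha>
  have "xcoeff_poly (0 :: ('a, 'n option) mfps) \<alpha> = 0"
    by (rule xcoeff_poly_eqI) (simp add: xcoeff_0)
  then show "mcoeff (eval_at \<tau> (0 :: ('a, 'n option) mfps)) \<alpha> = mcoeff 0 \<alpha>"
    by (simp add: mcoeff_eval_at)
qed

lemma eval_at_1: "eval_at \<tau> (1 :: ('a::field_char_0, 'n::finite option) mfps) = 1"
  using eval_at_mconst[of \<tau> 1, where 'b = 'n] by (simp add: mconst_1)

lemma eval_at_sum:
  fixes f :: "'i \<Rightarrow> ('a::field_char_0, 'n::finite option) mfps"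
  shows "(\<And>i. i \<in> I \<Longrightarrow> evaluative (f i)) \<Longrightarrow> eval_at \<tau> (sum f I) = (\<Sum>i\<in>I. eval_at \<tau> (f i))"
  by (induction I rule: infinite_finite_induct)
     (simp_all add: eval_at_0 eval_at_add evaluative_sum)

lemma eval_at_prod:
  fixes f :: "'i \<Rightarrow> ('a::field_char_0, 'n::finite option) mfps"
  shows "(\<And>i. i \<in> I \<Longrightarrow> evaluative (f i)) \<Longrightarrow> eval_at \<tau> (prod f I) = (\<Prod>i\<in>I. eval_at \<tau> (f i))"
  by (induction I rule: infinite_finite_induct)
     (simp_all add: eval_at_1 eval_at_mult evaluative_prod)

lemma eval_at_embed: "eval_at \<tau> (embed f) = f"
proof (rule mfps_eqI)
  fix \<alpha>
  have "xcoeff_poly (embed f) \<alpha> = [:mcoeff f \<alpha>:]"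
    by (rule xcoeff_poly_eqI) (simp add: xcoeff_embed fps_of_poly_const)
  then show "mcoeff (eval_at \<tau> (embed f)) \<alpha> = mcoeff f \<alpha>"
    by (simp add: mcoeff_eval_at)
qed

lemma eval_at_pderiv_Some:
  fixes f :: "('a::field_char_0, 'n::finite option) mfps"
  assumes "evaluative f"
  shows "eval_at \<tau> (pderiv_var (Some j) f) = pderiv_var j (eval_at \<tau> f)"
proof (rule mfps_eqI)
  fix \<alpha>
  have "xcoeff_poly (pderiv_var (Some j) f) \<alpha> =
      smult (of_nat (\<alpha> j + 1)) (xcoeff_poly f (\<alpha> + unit_exp j))"
    by (rule xcoeff_poly_eqI)
       (simp add: xcoeff_pderiv_Some fps_of_poly_smult fps_of_xcoeff_poly assms
         del: of_nat_add of_nat_Suc flip: fps_of_nat)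
  then show "mcoeff (eval_at \<tau> (pderiv_var (Some j) f)) \<alpha> = mcoeff (pderiv_var j (eval_at \<tau> f)) \<alpha>"
    by (simp add: mcoeff_eval_at pderiv_var_def)
qed

lemma eval_at_eq_0_iff:
  fixes f :: "('a::field_char_0, 'n::finite option) mfps"
  assumes "evaluative f"
  shows "eval_at \<tau> f = 0 \<longleftrightarrow> coeffs_in (poly_vanishing_at \<tau>) f"
proof -
  have "eval_at \<tau> f = 0 \<longleftrightarrow> (\<forall>\<alpha>. poly (xcoeff_poly f \<alpha>) \<tau> = 0)"
    by (metis mcoeff_eval_at mfps_eqI zero_mfps.rep_eq)
  also have "\<dots> \<longleftrightarrow> coeffs_in (poly_vanishing_at \<tau>) f"
    unfolding coeffs_in_def poly_vanishing_at_def
    by (auto simp: xcoeff_poly_eqI) (metis fps_of_xcoeff_poly[OF assms] xcoeff_poly_eqI)+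
  finally show ?thesis .
qed

lemma eval_at_constant_in_time:
  fixes f :: "('a::field_char_0, 'n::finite option) mfps"
  assumes "pderiv_var None f = 0"
  shows "evaluative f" and "eval_at \<tau> f = eval_at \<sigma> f"
proof -
  have c: "xcoeff f \<alpha> = fps_const (fps_nth (xcoeff f \<alpha>) 0)" for \<alpha>
    using xcoeff_pderiv_None[of f \<alpha>] by (simp add: assms xcoeff_0 fps_deriv_eq_0_iff)
  have f: "f = embed (at_time_zero f)"
    by (rule xcoeff_eqI, subst c) (simp add: xcoeff_embed at_time_zero_def)
  show "evaluative f" by (subst f) (rule evaluative_embed)
  show "eval_at \<tau> f = eval_at \<sigma> f" by (subst (1 2) f) (simp add: eval_at_embed)
qed

lemma eval_at_zero_eq_at_time_zero: "evaluative f \<Longrightarrow> eval_at 0 f = at_time_zero f"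
  by (rule mfps_eqI)
     (simp add: mcoeff_eval_at at_time_zero_def poly_0_coeff_0 flip: fps_of_xcoeff_poly)

section \<open>Tensor fields in coordinates\<close>

lemma finite_lists_of_length [simp]: "finite {is :: 'n::finite list. length is = k}"
  using finite_lists_length_eq[of "UNIV :: 'n set" k] by simp

lemma sum_lists_Suc:
  fixes f :: "'n::finite list \<Rightarrow> 'r::comm_ring_1"
  shows "(\<Sum>is | length is = Suc k. f is) = (\<Sum>i\<in>UNIV. \<Sum>is | length is = k. f (i # is))"
proof -
  have "{is. length is = Suc k} = (\<lambda>(i :: 'n, is). i # is) ` (UNIV \<times> {is. length is = k})"
    by (auto simp: length_Suc_conv image_iff)
  moreover have "inj_on (\<lambda>(i :: 'n, is). i # is) (UNIV \<times> {is. length is = k})"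
    by (auto simp: inj_on_def)
  ultimately show ?thesis
    by (simp add: sum.reindex sum.cartesian_product case_prod_unfold)
qed

lemma prod_sum_lists:
  fixes f :: "nat \<Rightarrow> 'n::finite \<Rightarrow> 'r::comm_ring_1"
  shows "(\<Prod>k<m. \<Sum>i\<in>UNIV. f k i) = (\<Sum>is | length is = m. \<Prod>k<m. f k (is ! k))"
proof (induction m arbitrary: f)
  case (Suc m)
  show ?case
    unfolding sum_lists_Suc prod.lessThan_Suc_shift
    by (simp add: Suc.IH[of "\<lambda>k. f (Suc k)"] sum_product flip: sum_distrib_left)
qed simp

text \<open>The interchange of summations behind the transformation law for tensor components.\<close>

lemma sum_lists_rearrange:
  fixes a :: "'b \<Rightarrow> 'c \<Rightarrow> 'r::comm_ring_1"
  shows "(\<Sum>i\<in>A. \<Sum>j\<in>B. a i j * (\<Sum>k\<in>C. p k i * w k) * (\<Sum>l\<in>D. u l * m l j)) =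
    (\<Sum>k\<in>C. \<Sum>l\<in>D. (\<Sum>i\<in>A. \<Sum>j\<in>B. a i j * p k i * m l j) * w k * u l)"
proof -
  have "(\<Sum>i\<in>A. \<Sum>j\<in>B. a i j * (\<Sum>k\<in>C. p k i * w k) * (\<Sum>l\<in>D. u l * m l j)) =
      (\<Sum>x\<in>A \<times> B. \<Sum>y\<in>C \<times> D. a (fst x) (snd x) * p (fst y) (fst x) * m (snd y) (snd x) * w (fst y) * u (snd y))"
    by (simp add: sum_distrib_left sum_distrib_right mult_ac sum.cartesian_product')
  also have "\<dots> = (\<Sum>y\<in>C \<times> D. \<Sum>x\<in>A \<times> B. a (fst x) (snd x) * p (fst y) (fst x) * m (snd y) (snd x) * w (fst y) * u (snd y))"
    by (rule sum.swap)
  also have "\<dots> = (\<Sum>k\<in>C. \<Sum>l\<in>D. (\<Sum>i\<in>A. \<Sum>j\<in>B. a i j * p k i * m l j) * w k * u l)"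
    by (simp add: sum_distrib_left sum_distrib_right sum.cartesian_product')
  finally show ?thesis .
qed

text \<open>Induction on the number of slots, expanding the first slot and regarding the result as a function
  of the remaining ones.\<close>

lemma multilinear_expand:
  fixes c :: "'b \<Rightarrow> 'n::finite \<Rightarrow> 'r::comm_ring_1"
  assumes "\<And>xs k w. length xs = r \<Longrightarrow> set xs \<subseteq> M \<Longrightarrow> k < r \<Longrightarrow> w \<in> M \<Longrightarrow>
      G (xs[k := w]) = (\<Sum>i\<in>UNIV. c w i * G (xs[k := b i]))"
    and b: "\<And>i. b i \<in> M" and "length xs = r" "set xs \<subseteq> M"
  shows "G xs = (\<Sum>is | length is = r. (\<Prod>k<r. c (xs ! k) (is ! k)) * G (map b is))"
  using assms(1,3,4)
proof (induction r arbitrary: G xs)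
  case (Suc r)
  note slot = Suc.prems(1)
  obtain y ys where xs: "xs = y # ys" and ys: "length ys = r" "set ys \<subseteq> M" and y: "y \<in> M"
    using Suc.prems(2,3) by (auto simp: length_Suc_conv)
  have IH: "G (b i # ys) = (\<Sum>is | length is = r. (\<Prod>k<r. c (ys ! k) (is ! k)) * G (b i # map b is))"
    for i
  proof (rule Suc.IH[of "\<lambda>zs. G (b i # zs)"])
    show "G (b i # zs[k := w]) = (\<Sum>j\<in>UNIV. c w j * G (b i # zs[k := b j]))"
      if "length zs = r" "set zs \<subseteq> M" "k < r" "w \<in> M" for zs k w
      using slot[of "b i # zs" "Suc k" w] that b by simp
  qed (fact ys)+
  have "G xs = (\<Sum>i\<in>UNIV. c y i * G (b i # ys))"
    using slot[of xs 0 y] xs ys y by simp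
  then show ?case
    unfolding sum_lists_Suc prod.lessThan_Suc_shift
    by (simp add: IH xs sum_distrib_left mult.assoc)
qed simp

text \<open>This isolates what the coordinate calculus needs, so that it applies both to formal and to
  time-dependent vector fields.\<close>

locale coordinate_module =
  fixes V :: "'r::comm_ring_1 vfield set" and x :: "'n::finite \<Rightarrow> 'r" and e :: "'n \<Rightarrow> 'r vfield"
  assumes V_add: "Y \<in> V \<Longrightarrow> Z \<in> V \<Longrightarrow> Y + Z \<in> V"
    and V_scale: "Y \<in> V \<Longrightarrow> (\<lambda>g. f * Y g) \<in> V"
    and e_in_V: "e i \<in> V"
    and e_x: "e i (x j) = (if i = j then 1 else 0)"
    and V_expand: "Y \<in> V \<Longrightarrow> Y g = (\<Sum>i\<in>UNIV. Y (x i) * e i g)"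
begin

abbreviation dx :: "'n \<Rightarrow> 'r oneform" where
  "dx i \<equiv> coord_form V (x i)"

lemma coord_form_in_one_forms: "coord_form V \<xi> \<in> one_forms V"
  by (auto simp: one_forms_def coord_form_def V_add V_scale)

lemma one_forms_add: "\<alpha> \<in> one_forms V \<Longrightarrow> \<beta> \<in> one_forms V \<Longrightarrow> \<alpha> + \<beta> \<in> one_forms V"
  by (simp add: one_forms_def algebra_simps)

lemma one_forms_scale: "\<alpha> \<in> one_forms V \<Longrightarrow> (\<lambda>Y. f * \<alpha> Y) \<in> one_forms V"
  by (simp add: one_forms_def algebra_simps)

text \<open>Stated for an arbitrary linear functional in order to serve both for one-forms and for each vector
  slot of a tensor.\<close>

lemma vfield_functional_expand:
  assumes add: "\<And>Y Z. Y \<in> V \<Longrightarrow> Z \<in> V \<Longrightarrow> G (Y + Z) = G Y + (G Z :: 'r)"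
    and scale: "\<And>f Y. Y \<in> V \<Longrightarrow> G (\<lambda>g. f * Y g) = f * G Y"
    and Y: "Y \<in> V"
  shows "G Y = (\<Sum>i\<in>UNIV. Y (x i) * G (e i))"
proof -
  have "(\<lambda>g. \<Sum>i\<in>I. c i * e i g) \<in> V \<and>
      G (\<lambda>g. \<Sum>i\<in>I. c i * e i g) = (\<Sum>i\<in>I. c i * G (e i))" if "finite I" for c I
    using that
  proof induction
    case empty
    show ?case using V_scale[OF e_in_V, of 0] scale[OF e_in_V, of 0] by simp
  next
    case (insert i I)
    have "(\<lambda>g. \<Sum>i\<in>insert i I. c i * e i g) = (\<lambda>g. c i * e i g) + (\<lambda>g. \<Sum>i\<in>I. c i * e i g)"
      using insert.hyps by (simp add: fun_eq_iff)
    then show ?case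
      using insert V_add[OF V_scale[OF e_in_V]] add[OF V_scale[OF e_in_V]] scale[OF e_in_V] by simp
  qed
  from this[of UNIV "\<lambda>i. Y (x i)"]
  have "G (\<lambda>g. \<Sum>i\<in>UNIV. Y (x i) * e i g) = (\<Sum>i\<in>UNIV. Y (x i) * G (e i))" by simp
  moreover have "Y = (\<lambda>g. \<Sum>i\<in>UNIV. Y (x i) * e i g)"
    by (rule ext) (rule V_expand[OF Y])
  ultimately show ?thesis by (simp only:)
qed

lemma one_form_expand:
  assumes "\<omega> \<in> one_forms V" "Y \<in> V"
  shows "\<omega> Y = (\<Sum>i\<in>UNIV. Y (x i) * \<omega> (e i))"
  using assms(1) by (intro vfield_functional_expand assms(2); unfold one_forms_def; blast)

lemma form_functional_expand:
  assumes add: "\<And>\<alpha> \<beta>. \<alpha> \<in> one_forms V \<Longrightarrow> \<beta> \<in> one_forms V \<Longrightarrow> G (\<alpha> + \<beta>) = G \<alpha> + (G \<beta> :: 'r)"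
    and scale: "\<And>f \<alpha>. \<alpha> \<in> one_forms V \<Longrightarrow> G (\<lambda>Y. f * \<alpha> Y) = f * G \<alpha>"
    and w: "\<omega> \<in> one_forms V"
  shows "G \<omega> = (\<Sum>i\<in>UNIV. \<omega> (e i) * G (dx i))"
proof -
  note dx = coord_form_in_one_forms
  have lin: "(\<lambda>Y. \<Sum>i\<in>I. c i * dx i Y) \<in> one_forms V \<and>
      G (\<lambda>Y. \<Sum>i\<in>I. c i * dx i Y) = (\<Sum>i\<in>I. c i * G (dx i))" if "finite I" for c I
    using that
  proof induction
    case empty
    show ?case using one_forms_scale[OF dx, of 0] scale[OF dx, of 0] by simp
  next
    case (insert i I)
    have "(\<lambda>Y. \<Sum>i\<in>insert i I. c i * dx i Y) = (\<lambda>Y. c i * dx i Y) + (\<lambda>Y. \<Sum>i\<in>I. c i * dx i Y)"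
      using insert.hyps by (simp add: fun_eq_iff)
    then show ?case
      using insert one_forms_add[OF one_forms_scale[OF dx]] add[OF one_forms_scale[OF dx]]
        scale[OF dx] by simp
  qed
  from lin[of UNIV "\<lambda>i. \<omega> (e i)"]
  have "G (\<lambda>Y. \<Sum>i\<in>UNIV. \<omega> (e i) * dx i Y) = (\<Sum>i\<in>UNIV. \<omega> (e i) * G (dx i))" by simp
  moreover have "\<omega> = (\<lambda>Y. \<Sum>i\<in>UNIV. \<omega> (e i) * dx i Y)"
  proof
    fix Y
    show "\<omega> Y = (\<Sum>i\<in>UNIV. \<omega> (e i) * dx i Y)"
    proof (cases "Y \<in> V")
      case True
      then show ?thesis by (simp add: one_form_expand[OF w] coord_form_def mult.commute)
    next
      case False
      then show ?thesis using w by (simp add: one_forms_def coord_form_def)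
    qed
  qed
  ultimately show ?thesis by (simp only:)
qed

lemma tensor_expand:
  assumes A: "A \<in> tensors V r s" and args: "tensor_args V r s \<omega>s Ys"
  shows "A \<omega>s Ys = (\<Sum>is | length is = r. \<Sum>js | length js = s. A (map dx is) (map e js)
      * (\<Prod>k<r. (\<omega>s ! k) (e (is ! k))) * (\<Prod>k<s. (Ys ! k) (x (js ! k))))"
proof -
  have \<omega>s: "length \<omega>s = r" "set \<omega>s \<subseteq> one_forms V" and Ys: "length Ys = s" "set Ys \<subseteq> V"
    using args by (auto simp: tensor_args_def)
  have form: "A us Ys = (\<Sum>is | length is = r. (\<Prod>k<r. (us ! k) (e (is ! k))) * A (map dx is) Ys)"
    if "length us = r" "set us \<subseteq> one_forms V" for us
  proof (rule multilinear_expand[where M = "one_forms V" and G = "\<lambda>us. A us Ys"])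
    show "A (us[k := w]) Ys = (\<Sum>i\<in>UNIV. w (e i) * A (us[k := dx i]) Ys)"
      if "length us = r" "set us \<subseteq> one_forms V" "k < r" "w \<in> one_forms V" for us k w
    proof (rule form_functional_expand[where G = "\<lambda>w. A (us[k := w]) Ys"])
      have "tensor_args V r s us Ys" using that Ys by (simp add: tensor_args_def)
      then show "A (us[k := \<alpha> + \<beta>]) Ys = A (us[k := \<alpha>]) Ys + A (us[k := \<beta>]) Ys"
        "A (us[k := (\<lambda>Y. f * \<alpha> Y)]) Ys = f * A (us[k := \<alpha>]) Ys"
        if "\<alpha> \<in> one_forms V" "\<beta> \<in> one_forms V" for \<alpha> \<beta> f
        using A that \<open>k < r\<close> by (auto simp: tensors_def)
    qed (fact that)
  qed (use that coord_form_in_one_forms in auto)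
  have vec: "A us Ys = (\<Sum>js | length js = s. (\<Prod>k<s. (Ys ! k) (x (js ! k))) * A us (map e js))"
    if us: "length us = r" "set us \<subseteq> one_forms V" for us
  proof (rule multilinear_expand[where M = V and G = "\<lambda>Ys. A us Ys" and c = "\<lambda>Y j. Y (x j)"])
    show "A us (Ys[k := w]) = (\<Sum>i\<in>UNIV. w (x i) * A us (Ys[k := e i]))"
      if "length Ys = s" "set Ys \<subseteq> V" "k < s" "w \<in> V" for Ys k w
    proof (rule vfield_functional_expand[where G = "\<lambda>w. A us (Ys[k := w])"])
      have "tensor_args V r s us Ys" using that us by (simp add: tensor_args_def)
      then show "A us (Ys[k := Y + Z]) = A us (Ys[k := Y]) + A us (Ys[k := Z])"
        "A us (Ys[k := (\<lambda>g. f * Y g)]) = f * A us (Ys[k := Y])"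
        if "Y \<in> V" "Z \<in> V" for Y Z f
        using A that \<open>k < s\<close> by (auto simp: tensors_def)
    qed (fact that)
  qed (use Ys e_in_V in auto)
  have "A (map dx is) Ys = (\<Sum>js | length js = s. (\<Prod>k<s. (Ys ! k) (x (js ! k))) *
      A (map dx is) (map e js))" if "length is = r" for "is"
    using that by (intro vec) (auto simp: coord_form_in_one_forms)
  then show ?thesis
    by (subst form[OF \<omega>s]) (simp add: sum_distrib_left mult_ac)
qed

end

lemma coordinate_module_formal:
  "coordinate_module (formal_vfields :: ('a::comm_ring_1, 'n::finite) mfps vfield set) mvar pderiv_var"
proof
  show "Y g = (\<Sum>i\<in>UNIV. Y (mvar i) * pderiv_var i g)"
    if "Y \<in> formal_vfields" for Y :: "('a, 'n) mfps vfield" and g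
    using that by (intro K_derivation_expand) (simp add: formal_vfields_def)
qed (simp_all add: formal_vfields_def K_derivation_add K_derivation_scale K_derivation_pderiv_var
       pderiv_var_mvar)

lemma sum_UNIV_option:
  fixes f :: "'n::finite option \<Rightarrow> 'b::comm_monoid_add"
  shows "sum f UNIV = f None + (\<Sum>i\<in>UNIV. f (Some i))"
  by (simp add: UNIV_option_conv sum.reindex)

lemma coordinate_module_time:
  "coordinate_module (time_vfields :: ('a::comm_ring_1, 'n::finite option) mfps vfield set)
     (\<lambda>i. mvar (Some i)) (\<lambda>i. pderiv_var (Some i))"
proof
  fix Y :: "('a, 'n option) mfps vfield" and g
  assume "Y \<in> time_vfields"
  then have Y: "K_derivation Y" "Y tvar = 0" by (auto simp: time_vfields_def)
  show "Y g = (\<Sum>i\<in>UNIV. Y (mvar (Some i)) * pderiv_var (Some i) g)"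
    using K_derivation_expand[OF Y(1), of g] unfolding sum_UNIV_option Y(2) by simp
qed (simp_all add: time_vfields_def K_derivation_add K_derivation_scale K_derivation_pderiv_var
       pderiv_var_mvar)

section \<open>Tensors with vanishing Lie derivative\<close>

lemma tensor_form_slots_cancel:
  assumes A: "A \<in> tensors V r s" and args: "tensor_args V r s \<omega>s Ys" and k: "k < r"
    and \<alpha>: "\<alpha> \<in> one_forms V" and \<beta>: "\<beta> \<in> one_forms V" and sum: "\<alpha> + \<beta> = 0"
  shows "A (\<omega>s[k := \<alpha>]) Ys + A (\<omega>s[k := \<beta>]) Ys = 0"
proof -
  have "A (\<omega>s[k := \<alpha> + \<beta>]) Ys = A (\<omega>s[k := \<alpha>]) Ys + A (\<omega>s[k := \<beta>]) Ys"
    and "A (\<omega>s[k := (\<lambda>Y. 0 * \<alpha> Y)]) Ys = 0 * A (\<omega>s[k := \<alpha>]) Ys"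
    using A args k \<alpha> \<beta> unfolding tensors_def by blast+
  moreover have "(\<lambda>Y. 0 * \<alpha> Y) = \<alpha> + \<beta>" by (simp add: sum fun_eq_iff)
  ultimately show ?thesis by simp
qed

lemma tensor_vfield_slots_cancel:
  assumes A: "A \<in> tensors V r s" and args: "tensor_args V r s \<omega>s Ys" and k: "k < s"
    and Y: "Y \<in> V" and Z: "Z \<in> V" and sum: "Y + Z = 0"
  shows "A \<omega>s (Ys[k := Y]) + A \<omega>s (Ys[k := Z]) = 0"
proof -
  have "A \<omega>s (Ys[k := Y + Z]) = A \<omega>s (Ys[k := Y]) + A \<omega>s (Ys[k := Z])"
    and "A \<omega>s (Ys[k := (\<lambda>g. 0 * Y g)]) = 0 * A \<omega>s (Ys[k := Y])"
    using A args k Y Z unfolding tensors_def by blast+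
  moreover have "(\<lambda>g. 0 * Y g) = Y + Z" by (simp add: sum fun_eq_iff)
  ultimately show ?thesis by simp
qed

text \<open>The terms of the Leibniz rule in which an argument is differentiated cancel in pairs, because
  each argument is itself invariant under \<open>Z + X\<close>.\<close>

lemma invariant_tensor_on_invariant_arguments:
  assumes A: "A \<in> tensors V r s" and args: "tensor_args V r s \<omega>s Ys"
    and L: "lie_derivative V r s Z A + lie_derivative V r s X A = 0"
    and forms: "\<And>\<omega>. \<omega> \<in> set \<omega>s \<Longrightarrow> lie_form V Z \<omega> \<in> one_forms V \<and> lie_form V X \<omega> \<in> one_forms V \<and>
        lie_form V Z \<omega> + lie_form V X \<omega> = 0"
    and vfields: "\<And>Y. Y \<in> set Ys \<Longrightarrow> lie_bracket Z Y \<in> V \<and> lie_bracket X Y \<in> V \<and>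
        lie_bracket Z Y + lie_bracket X Y = 0"
  shows "Z (A \<omega>s Ys) + X (A \<omega>s Ys) = 0"
proof -
  have len: "length \<omega>s = r" "length Ys = s" using args by (auto simp: tensor_args_def)
  have "(\<Sum>k<r. A (\<omega>s[k := lie_form V Z (\<omega>s ! k)]) Ys + A (\<omega>s[k := lie_form V X (\<omega>s ! k)]) Ys) = 0"
    using forms len by (intro sum.neutral ballI tensor_form_slots_cancel[OF A args]) auto
  moreover have "(\<Sum>k<s. A \<omega>s (Ys[k := lie_bracket Z (Ys ! k)]) + A \<omega>s (Ys[k := lie_bracket X (Ys ! k)])) = 0"
    using vfields len by (intro sum.neutral ballI tensor_vfield_slots_cancel[OF A args]) auto
  moreover have "lie_derivative V r s Z A \<omega>s Ys + lie_derivative V r s X A \<omega>s Ys = 0"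
    using fun_cong[OF fun_cong[OF L]] by simp
  ultimately show ?thesis
    using args by (simp add: lie_derivative_def sum.distrib algebra_simps)
qed

section \<open>Pullback of formal vector fields and forms\<close>

lemma inv_pullback_vfield:
  assumes "bij \<phi>"
  shows "inv (pullback_vfield \<phi>) Y = inv \<phi> \<circ> Y \<circ> \<phi>"
  by (rule inv_f_eq[OF bij_is_inj[OF bij_pullback_vfield[OF assms]]])
     (auto simp: pullback_vfield_def fun_eq_iff surj_f_inv_f[OF bij_is_surj[OF assms]])

lemma inv_pullback_form:
  assumes "bij \<phi>"
  shows "inv (pullback_form \<phi>) \<omega> = inv \<phi> \<circ> \<omega> \<circ> pullback_vfield \<phi>"
  by (rule inv_f_eq[OF bij_is_inj[OF bij_pullback_form[OF assms]]])
     (auto simp: pullback_form_def fun_eq_iff surj_f_inv_f[OF bij_is_surj[OF assms]]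
       surj_f_inv_f[OF bij_is_surj[OF bij_pullback_vfield[OF assms]]])

lemma pullback_vfield_formal:
  assumes \<psi>: "K_algebra_automorphism \<psi>" and Y: "Y \<in> formal_vfields"
  shows "pullback_vfield \<psi> Y \<in> formal_vfields"
  using K_derivation_conjugate[OF automorphism_inverse[OF \<psi>], of Y] Y
  by (simp add: formal_vfields_def pullback_vfield_def inv_inv_automorphism[OF \<psi>] o_def)

lemma inv_pullback_vfield_formal_iff:
  assumes \<psi>: "K_algebra_automorphism \<psi>"
  shows "inv (pullback_vfield \<psi>) Y \<in> formal_vfields \<longleftrightarrow> Y \<in> formal_vfields"
proof
  note b = automorphism_bij[OF \<psi>]
  have "pullback_vfield \<psi> (inv (pullback_vfield \<psi>) Y) = Y"
    by (rule surj_f_inv_f[OF bij_is_surj[OF bij_pullback_vfield[OF b]]])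
  then show "Y \<in> formal_vfields" if "inv (pullback_vfield \<psi>) Y \<in> formal_vfields"
    using pullback_vfield_formal[OF \<psi> that] by simp
  show "inv (pullback_vfield \<psi>) Y \<in> formal_vfields" if "Y \<in> formal_vfields"
    using K_derivation_conjugate[OF \<psi>, of Y] that
    by (simp add: formal_vfields_def inv_pullback_vfield[OF b] o_def)
qed

lemma pullback_form_formal:
  assumes \<psi>: "K_algebra_automorphism \<psi>" and \<omega>: "\<omega> \<in> one_forms formal_vfields"
  shows "pullback_form \<psi> \<omega> \<in> one_forms formal_vfields"
proof -
  note b = automorphism_bij[OF \<psi>] and inv\<psi> = automorphism_inverse[OF \<psi>]
  let ?P = "inv (pullback_vfield \<psi>)"
  have add: "?P (Y + Z) = ?P Y + ?P Z" for Y Z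
    by (auto simp: inv_pullback_vfield[OF b] fun_eq_iff automorphism_add[OF inv\<psi>])
  have scale: "?P (\<lambda>g. f * Y g) = (\<lambda>g. inv \<psi> f * ?P Y g)" for f Y
    by (auto simp: inv_pullback_vfield[OF b] fun_eq_iff automorphism_mult[OF inv\<psi>])
  show ?thesis
    using \<omega>
    by (auto simp: one_forms_def pullback_form_def add scale automorphism_0[OF \<psi>]
        automorphism_add[OF \<psi>] automorphism_mult[OF \<psi>] automorphism_inv[OF \<psi>]
        inv_pullback_vfield_formal_iff[OF \<psi>])
qed

lemma inv_pullback_form_formal_iff:
  assumes \<psi>: "K_algebra_automorphism \<psi>"
  shows "inv (pullback_form \<psi>) \<omega> \<in> one_forms formal_vfields \<longleftrightarrow> \<omega> \<in> one_forms formal_vfields"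
proof
  note b = automorphism_bij[OF \<psi>] and inv\<psi> = automorphism_inverse[OF \<psi>]
  have "pullback_form \<psi> (inv (pullback_form \<psi>) \<omega>) = \<omega>"
    by (rule surj_f_inv_f[OF bij_is_surj[OF bij_pullback_form[OF b]]])
  then show "\<omega> \<in> one_forms formal_vfields" if "inv (pullback_form \<psi>) \<omega> \<in> one_forms formal_vfields"
    using pullback_form_formal[OF \<psi> that] by simp
  have "inv (pullback_vfield (inv \<psi>)) = pullback_vfield \<psi>"
    by (rule ext)
       (simp add: inv_pullback_vfield[OF automorphism_bij[OF inv\<psi>]] inv_inv_automorphism[OF \<psi>]
         pullback_vfield_def)
  then have "inv (pullback_form \<psi>) \<omega> = pullback_form (inv \<psi>) \<omega>"
    by (simp add: inv_pullback_form[OF b] pullback_form_def)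
  then show "inv (pullback_form \<psi>) \<omega> \<in> one_forms formal_vfields" if "\<omega> \<in> one_forms formal_vfields"
    using pullback_form_formal[OF inv\<psi> that] by simp
qed

lemma tensor_of_components_cong:
  assumes "\<And>is js. length is = r \<Longrightarrow> length js = s \<Longrightarrow> c is js = d is js"
  shows "tensor_of_components r s c = tensor_of_components r s d"
proof -
  have "(\<Sum>is | length is = r. \<Sum>js | length js = s. c is js * u is * v js) =
      (\<Sum>is | length is = r. \<Sum>js | length js = s. d is js * u is * v js)" for u v
    by (intro sum.cong refl) (simp add: assms)
  then show ?thesis by (simp only: tensor_of_components_def)
qed

text \<open>The transformation law for components. It comes from expanding \<open>\<psi>\<^sup>* \<partial>\<^sub>k\<close> and \<open>Y\<close> in the coordinate
  basis: the first product consists of entries of the inverse Jacobian matrix, expressed through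
  \<open>\<psi>\<^bsup>-1\<^esup>\<close>, and the second of entries of the Jacobian matrix.\<close>

lemma pullback_tensor_of_components:
  fixes c :: "'n::finite list \<Rightarrow> 'n list \<Rightarrow> ('a::field_char_0, 'n) mfps"
  assumes \<psi>: "K_algebra_automorphism \<psi>"
  shows "pullback_tensor \<psi> (tensor_of_components r s c) =
    tensor_of_components r s (\<lambda>is js. \<Sum>ks | length ks = r. \<Sum>ls | length ls = s.
      \<psi> (c ks ls) * (\<Prod>k<r. \<psi> (pderiv_var (ks ! k) (inv \<psi> (mvar (is ! k)))))
        * (\<Prod>k<s. pderiv_var (js ! k) (\<psi> (mvar (ls ! k)))))"
  (is "?lhs = tensor_of_components r s ?c'")
proof (intro ext)
  fix \<omega>s :: "('a, 'n) mfps oneform list" and Ys :: "('a, 'n) mfps vfield list"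
  interpret coordinate_module "formal_vfields :: ('a, 'n) mfps vfield set" mvar pderiv_var
    by (rule coordinate_module_formal)
  note b = automorphism_bij[OF \<psi>]
  let ?\<omega>s = "map (inv (pullback_form \<psi>)) \<omega>s" and ?Ys = "map (inv (pullback_vfield \<psi>)) Ys"
  have args_iff: "tensor_args formal_vfields r s ?\<omega>s ?Ys \<longleftrightarrow> tensor_args formal_vfields r s \<omega>s Ys"
    by (simp only: tensor_args_def length_map set_map subset_eq ball_simps
        inv_pullback_form_formal_iff[OF \<psi>] inv_pullback_vfield_formal_iff[OF \<psi>])
  show "?lhs \<omega>s Ys = tensor_of_components r s ?c' \<omega>s Ys"
  proof (cases "tensor_args formal_vfields r s \<omega>s Ys")
    case False
    then show ?thesis
      by (simp add: pullback_tensor_def tensor_of_components_def args_iff automorphism_0[OF \<psi>])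
  next
    case True
    then have len: "length \<omega>s = r" "length Ys = s"
      and \<omega>: "\<And>k. k < r \<Longrightarrow> \<omega>s ! k \<in> one_forms formal_vfields"
      and Y: "\<And>k. k < s \<Longrightarrow> Ys ! k \<in> formal_vfields"
      by (auto simp: tensor_args_def)
    define P where "P i k = \<psi> (pderiv_var k (inv \<psi> (mvar i)))" for i k
    define M where "M j l = pderiv_var j (\<psi> (mvar l))" for j l
    have form: "\<psi> (inv (pullback_form \<psi>) (\<omega>s ! m) (pderiv_var k)) =
        (\<Sum>i\<in>UNIV. P i k * (\<omega>s ! m) (pderiv_var i))" if "m < r" for m k
      using one_form_expand[OF \<omega>[OF that] pullback_vfield_formal[OF \<psi> e_in_V, of k]]
      by (simp add: inv_pullback_form[OF b] automorphism_inv[OF \<psi>] P_def pullback_vfield_def)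
    have vec: "\<psi> (coord_form formal_vfields (mvar l) (inv (pullback_vfield \<psi>) (Ys ! m))) =
        (\<Sum>j\<in>UNIV. (Ys ! m) (mvar j) * M j l)" if "m < s" for m l
    proof -
      have "coord_form formal_vfields (mvar l) (inv (pullback_vfield \<psi>) (Ys ! m)) =
          inv (pullback_vfield \<psi>) (Ys ! m) (mvar l)"
        using Y[OF that] by (simp add: coord_form_def inv_pullback_vfield_formal_iff[OF \<psi>])
      then show ?thesis
        using V_expand[OF Y[OF that], of "\<psi> (mvar l)"]
        by (simp add: inv_pullback_vfield[OF b] automorphism_inv[OF \<psi>] M_def)
    qed
    have "?lhs \<omega>s Ys = (\<Sum>ks | length ks = r. \<Sum>ls | length ls = s. \<psi> (c ks ls)
        * (\<Prod>m<r. \<Sum>i\<in>UNIV. P i (ks ! m) * (\<omega>s ! m) (pderiv_var i))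
        * (\<Prod>m<s. \<Sum>j\<in>UNIV. (Ys ! m) (mvar j) * M j (ls ! m)))"
      using True
      by (simp add: pullback_tensor_def tensor_of_components_def args_iff automorphism_sum[OF \<psi>]
          automorphism_mult[OF \<psi>] automorphism_prod[OF \<psi>] len form vec)
    also have "\<dots> = (\<Sum>is | length is = r. \<Sum>js | length js = s.
        (\<Sum>ks | length ks = r. \<Sum>ls | length ls = s. \<psi> (c ks ls)
          * (\<Prod>m<r. P (is ! m) (ks ! m)) * (\<Prod>m<s. M (js ! m) (ls ! m)))
        * (\<Prod>m<r. (\<omega>s ! m) (pderiv_var (is ! m))) * (\<Prod>m<s. (Ys ! m) (mvar (js ! m))))"
      unfolding prod_sum_lists prod.distrib by (rule sum_lists_rearrange)
    also have "\<dots> = tensor_of_components r s ?c' \<omega>s Ys"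
      using True Y by (simp add: tensor_of_components_def P_def M_def coord_form_def)
    finally show ?thesis .
  qed
qed

text \<open>The bracket of the two partial derivatives is a derivation that kills all variables.\<close>

lemma pderiv_commute: "pderiv_var None (pderiv_var (Some j) f) =
    pderiv_var (Some j) (pderiv_var None (f :: ('a::comm_ring_1, 'n::finite option) mfps))"
proof -
  have "lie_bracket (pderiv_var None) (pderiv_var (Some j)) \<in> (time_vfields :: ('a, 'n option) mfps vfield set)"
    by (rule lie_bracket_in_time_vfields) (simp_all add: pderiv_var_in_time_vfields)
  then have "K_derivation (lie_bracket (pderiv_var None) (pderiv_var (Some j) :: ('a, 'n option) mfps vfield))"
    by (simp add: time_vfields_def)
  then have "lie_bracket (pderiv_var None) (pderiv_var (Some j)) f = 0"
    by (rule K_derivation_eq_zero)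
       (simp add: lie_bracket_def pderiv_var_mvar K_derivation_0_1[OF K_derivation_pderiv_var])
  then show ?thesis by (simp add: lie_bracket_def)
qed

section \<open>Evaluative isotopies\<close>

locale polynomial_isotopy =
  fixes \<phi> :: "('a::field_char_0, 'n::finite option) mfps \<Rightarrow> ('a, 'n option) mfps"
  assumes evaluative_isotopy: "evaluative_isotopy \<phi>"
begin

lemma aut: "K_algebra_automorphism \<phi>" and image_tvar: "\<phi> tvar = tvar"
  and evaluative_image_var: "evaluative (\<phi> (mvar (Some i)))"
  and image_var_at_origin: "xcoeff (\<phi> (mvar (Some i))) 0 = 0"
  and invertible_jacobian: "invertible (jacobian_at_origin \<phi>)"
  using evaluative_isotopy by (auto simp: evaluative_isotopy_def formal_isotopy_def)

abbreviation jac :: "'n \<Rightarrow> 'n \<Rightarrow> ('a, 'n option) mfps" where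
  "jac j k \<equiv> pderiv_var (Some j) (\<phi> (mvar (Some k)))"

lemma evaluative_jac: "evaluative (jac j k)"
  by (intro evaluative_pderiv_Some evaluative_image_var)

text \<open>The \<open>t\<close>-term of the chain rule drops out because \<open>\<phi>\<close> fixes \<open>t\<close>.\<close>

lemma pderiv_image:
  "pderiv_var (Some j) (\<phi> h) = (\<Sum>k\<in>UNIV. jac j k * \<phi> (pderiv_var (Some k) h))"
  by (simp add: chain_rule[OF aut K_derivation_pderiv_var, of "Some j" h] sum_UNIV_option
      image_tvar pderiv_var_mvar)

text \<open>The isotopy fixes the origin at all times. Writing \<open>h = c + t g + \<Sum> x\<^sup>i g\<^sub>i\<close>, the terms \<open>x\<^sup>i g\<^sub>i\<close> and their
  images vanish at \<open>x = 0\<close>, and \<open>g\<close> is treated by induction on the power of \<open>t\<close>.\<close>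

lemma xcoeff_image_0: "xcoeff (\<phi> h) 0 = xcoeff h 0"
proof (rule fps_ext)
  fix k
  have step: "\<exists>c g. xcoeff h 0 = fps_const c + fps_X * xcoeff g 0 \<and>
      xcoeff (\<phi> h) 0 = fps_const c + fps_X * xcoeff (\<phi> g) 0" for h
  proof -
    define c where "c = mcoeff h 0"
    obtain g where "h = mconst c + (\<Sum>v\<in>UNIV. mvar v * g v)"
      unfolding c_def by (rule mfps_decompose)
    then have h: "h = mconst c + (tvar * g None + (\<Sum>i\<in>UNIV. mvar (Some i) * g (Some i)))"
      by (simp add: sum_UNIV_option)
    have "xcoeff (mvar (Some i) :: ('a, 'n option) mfps) 0 = 0" for i
      by (simp add: xcoeff_mvar_Some unit_exp_def fun_eq_iff)
    then have "xcoeff (mvar (Some i) * f) 0 = 0" "xcoeff (\<phi> (mvar (Some i)) * f) 0 = 0" for i f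
      by (simp_all add: xcoeff_mult_0 image_var_at_origin)
    note expand = xcoeff_add xcoeff_mconst xcoeff_sum xcoeff_tvar_mult this
    have "xcoeff h 0 = fps_const c + fps_X * xcoeff (g None) 0"
      unfolding h by (simp add: expand)
    moreover have "xcoeff (\<phi> h) 0 = fps_const c + fps_X * xcoeff (\<phi> (g None)) 0"
      unfolding h
      by (simp add: automorphism_add[OF aut] automorphism_mult[OF aut] automorphism_mconst[OF aut]
          automorphism_sum[OF aut] image_tvar expand)
    ultimately show ?thesis by blast
  qed
  show "fps_nth (xcoeff (\<phi> h) 0) k = fps_nth (xcoeff h 0) k"
  proof (induction k arbitrary: h)
    case 0
    obtain c g where h: "xcoeff h 0 = fps_const c + fps_X * xcoeff g 0"
      and image: "xcoeff (\<phi> h) 0 = fps_const c + fps_X * xcoeff (\<phi> g) 0"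
      using step[of h] by blast
    show ?case unfolding h image by simp
  next
    case (Suc k)
    obtain c g where h: "xcoeff h 0 = fps_const c + fps_X * xcoeff g 0"
      and image: "xcoeff (\<phi> h) 0 = fps_const c + fps_X * xcoeff (\<phi> g) 0"
      using step[of h] by blast
    show ?case unfolding h image by (simp, rule Suc.IH)
  qed
qed

text \<open>By the chain rule the partial derivatives of \<open>\<phi> h\<close> are combinations, with evaluative coefficients,
  of images of partial derivatives of \<open>h\<close>. This lowers the degree, and at degree \<open>0\<close> the series \<open>\<phi> h\<close>
  and \<open>h\<close> agree.\<close>

lemma image_coeffs_in:
  assumes S: "poly_submodule S" and h: "coeffs_in S h"
  shows "coeffs_in S (\<phi> h)"
proof -
  have "xcoeff (\<phi> h) \<alpha> \<in> S" for \<alpha>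
    using h
  proof (induction \<alpha> arbitrary: h rule: measure_induct_rule[where f = "\<lambda>\<alpha>. sum \<alpha> UNIV"])
    case (less \<alpha>)
    show ?case
    proof (cases "\<alpha> = 0")
      case True
      then show ?thesis using less.prems by (metis coeffs_in_def xcoeff_image_0)
    next
      case False
      then obtain j where j: "\<alpha> j \<noteq> 0" by (rule exponent_nonzero_obtain)
      have "xcoeff (jac j k) (fst p) * xcoeff (\<phi> (pderiv_var (Some k) h)) (snd p) \<in> S"
        if "p \<in> splits (\<alpha> - unit_exp j)" for k p
      proof -
        have "\<alpha> - unit_exp j = fst p + snd p" using that by (auto simp: splits_def)
        then have "sum (snd p) UNIV \<le> sum (\<alpha> - unit_exp j) UNIV"
          by (simp add: sum_mono)
        then have "sum (snd p) UNIV < sum \<alpha> UNIV"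
          using exponent_sum_decrease[of \<alpha> j, OF j] by (rule order.strict_trans1)
        then have "xcoeff (\<phi> (pderiv_var (Some k) h)) (snd p) \<in> S"
          using coeffs_in_pderiv_Some[OF S less.prems] by (rule less.IH)
        then show ?thesis
          by (metis evaluative_jac fps_of_xcoeff_poly submodule_mult[OF S])
      qed
      then have "xcoeff (pderiv_var (Some j) (\<phi> h)) (\<alpha> - unit_exp j) \<in> S"
        by (subst pderiv_image) (simp only: xcoeff_sum xcoeff_mult case_prod_unfold
            submodule_sum[OF S])
      then show ?thesis by (rule xcoeff_in_if_pderiv[OF S, of \<alpha> j, OF j])
    qed
  qed
  then show ?thesis by (simp add: coeffs_in_def)
qed

text \<open>The Jacobian matrix is invertible over \<open>K[t]\<close> at \<open>x = 0\<close>, so a linear system with this matrix can be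
  solved for the coefficients of degree \<open>d\<close> of the unknowns, modulo terms that involve their
  coefficients of degree below \<open>d\<close>.\<close>

lemma jacobian_system_coeffs_in:
  assumes S: "poly_submodule S" and sys: "\<And>j. coeffs_in S (\<Sum>k\<in>UNIV. jac j k * h k)"
  shows "coeffs_in S (h l)"
proof -
  define J where "J = jacobian_at_origin \<phi>"
  obtain B where B: "J ** B = mat 1"
    using invertible_jacobian by (auto simp: invertible_def J_def)
  have J: "xcoeff (jac j k) 0 = fps_of_poly (J $ k $ j)" for j k
    by (simp add: J_def jacobian_at_origin_def fps_of_xcoeff_poly[OF evaluative_jac])
  have minus: "u - v \<in> S" if "u \<in> S" "v \<in> S" for u v
    using submodule_add[OF S that(1) submodule_mult[OF S that(2), of "- 1"]]
    by (simp add: fps_of_poly_uminus)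
  have "xcoeff (h l) \<alpha> \<in> S" for \<alpha>
  proof (induction \<alpha> arbitrary: l rule: measure_induct_rule[where f = "\<lambda>\<alpha>. sum \<alpha> UNIV"])
    case (less \<alpha>)
    \<comment> \<open>The convolution without its term of degree 0 in the matrix entry.\<close>
    define R where "R j k = (\<Sum>p\<in>splits \<alpha> - {(0, \<alpha>)}. xcoeff (jac j k) (fst p) * xcoeff (h k) (snd p))"
      for j k
    have R: "R j k \<in> S" for j k
      unfolding R_def
    proof (rule submodule_sum[OF S])
      fix p assume p: "p \<in> splits \<alpha> - {(0, \<alpha>)}"
      then have \<alpha>: "\<alpha> = fst p + snd p" by (auto simp: splits_def)
      with p have "fst p \<noteq> 0" by (cases p) auto
      then obtain v where "fst p v \<noteq> 0" by (rule exponent_nonzero_obtain)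
      then have "sum (snd p) UNIV < sum \<alpha> UNIV"
        unfolding \<alpha> by (intro sum_strict_mono_ex1) (auto intro!: bexI[of _ v])
      then have "xcoeff (h k) (snd p) \<in> S" by (rule less.IH)
      then show "xcoeff (jac j k) (fst p) * xcoeff (h k) (snd p) \<in> S"
        by (metis evaluative_jac fps_of_xcoeff_poly submodule_mult[OF S])
    qed
    have "xcoeff (jac j k * h k) \<alpha> = fps_of_poly (J $ k $ j) * xcoeff (h k) \<alpha> + R j k" for j k
      unfolding xcoeff_mult R_def case_prod_unfold
      by (subst sum.remove[OF finite_splits, of "(0, \<alpha>)"]) (auto simp: J splits_def)
    then have "(\<Sum>k\<in>UNIV. fps_of_poly (J $ k $ j) * xcoeff (h k) \<alpha>) =
        xcoeff (\<Sum>k\<in>UNIV. jac j k * h k) \<alpha> - (\<Sum>k\<in>UNIV. R j k)" for j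
      by (simp add: xcoeff_sum sum.distrib)
    then have D: "(\<Sum>k\<in>UNIV. fps_of_poly (J $ k $ j) * xcoeff (h k) \<alpha>) \<in> S" for j
      using sys[of j] by (simp add: minus submodule_sum[OF S] R coeffs_in_def)
    have "(\<Sum>j\<in>UNIV. fps_of_poly (B $ j $ l) * (\<Sum>k\<in>UNIV. fps_of_poly (J $ k $ j) * xcoeff (h k) \<alpha>)) =
        (\<Sum>k\<in>UNIV. fps_of_poly ((J ** B) $ k $ l) * xcoeff (h k) \<alpha>)"
      unfolding sum_distrib_left
      by (subst sum.swap) (simp add: matrix_matrix_mult_def fps_of_poly_sum fps_of_poly_mult
          sum_distrib_left sum_distrib_right mult_ac)
    also have "\<dots> = (\<Sum>k\<in>UNIV. if k = l then xcoeff (h k) \<alpha> else 0)"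
      unfolding B by (intro sum.cong refl) (simp add: mat_def)
    finally have "xcoeff (h l) \<alpha> =
        (\<Sum>j\<in>UNIV. fps_of_poly (B $ j $ l) * (\<Sum>k\<in>UNIV. fps_of_poly (J $ k $ j) * xcoeff (h k) \<alpha>))"
      by simp
    also have "\<dots> \<in> S"
      by (intro submodule_sum[OF S] submodule_mult[OF S] D)
    finally show ?case .
  qed
  then show ?thesis by (simp add: coeffs_in_def)
qed

text \<open>This equivalence plays the role of a formal inverse function theorem. For \<open>S = K[t]\<close> it says that
  \<open>\<phi>\<^bsup>-1\<^esup>\<close> preserves evaluative series, which gives surjectivity of \<open>\<phi>\<^sub>\<tau>\<close>; for \<open>S = (t - \<tau>) K[t]\<close> it gives
  injectivity.\<close>

lemma coeffs_in_image_iff: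
  assumes S: "poly_submodule S"
  shows "coeffs_in S (\<phi> h) \<longleftrightarrow> coeffs_in S h"
proof
  assume h: "coeffs_in S (\<phi> h)"
  have "xcoeff h \<alpha> \<in> S" for \<alpha>
    using h
  proof (induction \<alpha> arbitrary: h rule: measure_induct_rule[where f = "\<lambda>\<alpha>. sum \<alpha> UNIV"])
    case (less \<alpha>)
    show ?case
    proof (cases "\<alpha> = 0")
      case True
      then show ?thesis using less.prems by (metis coeffs_in_def xcoeff_image_0)
    next
      case False
      then obtain j where j: "\<alpha> j \<noteq> 0" by (rule exponent_nonzero_obtain)
      have "coeffs_in S (\<Sum>k\<in>UNIV. jac i k * \<phi> (pderiv_var (Some k) h))" for i
        unfolding pderiv_image[symmetric] by (rule coeffs_in_pderiv_Some[OF S less.prems])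
      then have "coeffs_in S (\<phi> (pderiv_var (Some j) h))"
        by (rule jacobian_system_coeffs_in[OF S, where h = "\<lambda>k. \<phi> (pderiv_var (Some k) h)"])
      from less.IH[OF exponent_sum_decrease[of \<alpha> j, OF j] this] show ?thesis
        by (rule xcoeff_in_if_pderiv[OF S, of \<alpha> j, OF j])
    qed
  qed
  then show "coeffs_in S h" by (simp add: coeffs_in_def)
qed (rule image_coeffs_in[OF S])

lemma evaluative_image_iff: "evaluative (\<phi> h) \<longleftrightarrow> evaluative h"
  unfolding evaluative_iff by (rule coeffs_in_image_iff[OF poly_submodule_polys])

lemma evaluative_inv_image: "evaluative h \<Longrightarrow> evaluative (inv \<phi> h)"
  by (subst evaluative_image_iff[symmetric]) (simp only: automorphism_inv[OF aut])

lemma eval_image_eq_0_iff: "evaluative h \<Longrightarrow> eval_at \<tau> (\<phi> h) = 0 \<longleftrightarrow> eval_at \<tau> h = 0"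
  by (simp only: eval_at_eq_0_iff evaluative_image_iff coeffs_in_image_iff[OF poly_submodule_vanishing])

text \<open>The formal diffeomorphism \<open>\<phi>\<^sub>\<tau>\<close>, defined directly from \<open>\<phi>\<close> rather than by its values on the
  variables.\<close>

definition slice :: "'a \<Rightarrow> ('a, 'n) mfps \<Rightarrow> ('a, 'n) mfps" where
  "slice \<tau> f = eval_at \<tau> (\<phi> (embed f))"

lemma eval_image_eq_iff:
  assumes g: "evaluative g" and h: "evaluative h"
  shows "eval_at \<tau> (\<phi> g) = eval_at \<tau> (\<phi> h) \<longleftrightarrow> eval_at \<tau> g = eval_at \<tau> h"
proof -
  let ?d = "g + mconst (- 1) * h"
  have m1: "mconst (- 1) * f = - f" for f :: "('a, 'n) mfps"
    by (rule mfps_eqI) (simp add: mcoeff_mconst_mult)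
  note e = evaluative_add evaluative_mult evaluative_mconst
  have "eval_at \<tau> ?d = eval_at \<tau> g - eval_at \<tau> h"
    using g h by (simp add: eval_at_add eval_at_mult eval_at_mconst m1 e)
  moreover have "eval_at \<tau> (\<phi> ?d) = eval_at \<tau> (\<phi> g) - eval_at \<tau> (\<phi> h)"
    using g h by (simp add: automorphism_add[OF aut] automorphism_mult[OF aut] automorphism_mconst[OF aut]
        eval_at_add eval_at_mult eval_at_mconst m1 e evaluative_image_iff)
  moreover have "evaluative ?d" using g h by (intro e)
  ultimately show ?thesis using eval_image_eq_0_iff[of ?d \<tau>] by simp
qed

lemma eval_image: "evaluative h \<Longrightarrow> eval_at \<tau> (\<phi> h) = slice \<tau> (eval_at \<tau> h)"
  unfolding slice_def by (subst eval_image_eq_iff) (auto simp: evaluative_embed eval_at_embed)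

lemma slice_automorphism: "K_algebra_automorphism (slice \<tau>)"
  unfolding K_algebra_automorphism_def
proof (intro conjI allI)
  note e = evaluative_embed eval_at_embed evaluative_image_iff
  show "bij (slice \<tau>)"
  proof (rule bijI)
    show "inj (slice \<tau>)"
    proof (rule injI)
      show "f = g" if "slice \<tau> f = slice \<tau> g" for f g
        using that eval_image_eq_iff[of "embed f" "embed g" \<tau>] by (simp add: slice_def e)
    qed
    show "surj (slice \<tau>)"
    proof (rule surjI)
      show "slice \<tau> (eval_at \<tau> (inv \<phi> (embed g))) = g" for g
        using eval_image[of "inv \<phi> (embed g)" \<tau>]
        by (simp add: evaluative_inv_image e automorphism_inv[OF aut])
    qed
  qed
  show "slice \<tau> 1 = 1"
    using eval_image[OF evaluative_mconst, of \<tau> 1]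
    by (simp add: automorphism_mconst[OF aut] eval_at_mconst) (simp add: mconst_1)
  show "slice \<tau> (f + g) = slice \<tau> f + slice \<tau> g" for f g
    using eval_image[of "embed f + embed g" \<tau>]
    by (simp add: slice_def automorphism_add[OF aut] eval_at_add evaluative_add e)
  show "slice \<tau> (f * g) = slice \<tau> f * slice \<tau> g" for f g
    using eval_image[of "embed f * embed g" \<tau>]
    by (simp add: slice_def automorphism_mult[OF aut] eval_at_mult evaluative_mult e)
  show "slice \<tau> (mconst c * f) = mconst c * slice \<tau> f" for c f
    using eval_image[of "mconst c * embed f" \<tau>]
    by (simp add: slice_def automorphism_scale[OF aut] eval_at_mult eval_at_mconst evaluative_mult
        evaluative_mconst e)
qed

lemma slice_mvar: "slice \<tau> (mvar i) = eval_at \<tau> (\<phi> (mvar (Some i)))"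
  by (simp add: slice_def embed_mvar)

lemma isotopy_at_eq_slice: "isotopy_at \<tau> \<phi> = slice \<tau>"
  unfolding isotopy_at_def
proof (rule the_equality)
  show "formal_diffeo (slice \<tau>) \<and> (\<forall>i. slice \<tau> (mvar i) = eval_at \<tau> (\<phi> (mvar (Some i))))"
    by (simp add: slice_automorphism slice_mvar)
  fix \<psi> assume "formal_diffeo \<psi> \<and> (\<forall>i. \<psi> (mvar i) = eval_at \<tau> (\<phi> (mvar (Some i))))"
  then show "\<psi> = slice \<tau>"
    by (intro automorphism_eqI slice_automorphism) (simp_all add: slice_mvar)
qed

lemma eval_inv_image:
  assumes "evaluative h"
  shows "eval_at \<tau> (inv \<phi> h) = inv (slice \<tau>) (eval_at \<tau> h)"
proof -
  have "slice \<tau> (eval_at \<tau> (inv \<phi> h)) = eval_at \<tau> h"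
    using eval_image[OF evaluative_inv_image[OF assms], of \<tau>] by (simp add: automorphism_inv[OF aut])
  then show ?thesis by (metis automorphism_inv(2)[OF slice_automorphism])
qed

section \<open>The components of the pulled back tensor field\<close>

text \<open>The components of the time-dependent tensor field \<open>\<phi>\<^sup>* A\<close>, that is \<open>\<phi>\<close> of the value of \<open>A\<close> on the
  inverse pullbacks of the coordinate forms and fields. The inverse pullback of \<open>dx\<^sup>i\<close> is the
  differential of \<open>\<phi>\<^bsup>-1\<^esup> x\<^sup>i\<close>.\<close>

definition moving_component ::
    "('a, 'n option) mfps tensor \<Rightarrow> 'n list \<Rightarrow> 'n list \<Rightarrow> ('a, 'n option) mfps" where
  "moving_component A is js =
     \<phi> (A (map (\<lambda>i. coord_form time_vfields (inv \<phi> (mvar (Some i)))) is)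
          (map (\<lambda>j f. inv \<phi> (pderiv_var (Some j) (\<phi> f))) js))"

lemma conjugated_pderiv_in_time_vfields:
  "(\<lambda>f. inv \<phi> (pderiv_var (Some j) (\<phi> f))) \<in> time_vfields"
  using K_derivation_conjugate[OF aut K_derivation_pderiv_var, of "Some j"]
  by (simp add: time_vfields_def image_tvar pderiv_var_mvar
      automorphism_0[OF automorphism_inverse[OF aut]])

lemma moving_component_args:
  assumes "length is = r" "length js = s"
  shows "tensor_args time_vfields r s
     (map (\<lambda>i. coord_form time_vfields (inv \<phi> (mvar (Some i)))) is)
     (map (\<lambda>j f. inv \<phi> (pderiv_var (Some j) (\<phi> f))) js)"
  unfolding tensor_args_def set_map
  by (intro conjI image_subsetI conjugated_pderiv_in_time_vfields
      coordinate_module.coord_form_in_one_forms[OF coordinate_module_time]) (simp_all add: assms)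

lemma moving_component_expand:
  assumes A: "A \<in> tensors time_vfields r s" and len: "length is = r" "length js = s"
  shows "moving_component A is js = (\<Sum>ks | length ks = r. \<Sum>ls | length ls = s.
    \<phi> (time_component A ks ls)
      * (\<Prod>k<r. \<phi> (pderiv_var (Some (ks ! k)) (inv \<phi> (mvar (Some (is ! k))))))
      * (\<Prod>k<s. jac (js ! k) (ls ! k)))"
proof -
  let ?\<theta>s = "map (\<lambda>i. coord_form time_vfields (inv \<phi> (mvar (Some i)))) is"
  let ?Ys = "map (\<lambda>j f. inv \<phi> (pderiv_var (Some j) (\<phi> f))) js"
  have forms: "\<phi> ((?\<theta>s ! k) (pderiv_var (Some i))) = \<phi> (pderiv_var (Some i) (inv \<phi> (mvar (Some (is ! k)))))"
    if "k < r" for k i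
    using that len by (simp add: coord_form_def pderiv_var_in_time_vfields)
  have vfields: "\<phi> ((?Ys ! k) (mvar (Some l))) = jac (js ! k) l" if "k < s" for k l
    using that len by (simp add: automorphism_inv[OF aut])
  have expand: "A ?\<theta>s ?Ys = (\<Sum>ks | length ks = r. \<Sum>ls | length ls = s. time_component A ks ls
      * (\<Prod>k<r. (?\<theta>s ! k) (pderiv_var (Some (ks ! k)))) * (\<Prod>k<s. (?Ys ! k) (mvar (Some (ls ! k)))))"
    unfolding time_component_def
    by (rule coordinate_module.tensor_expand[OF coordinate_module_time A moving_component_args[OF len]])
  show ?thesis
    unfolding moving_component_def expand
    unfolding automorphism_sum[OF aut] automorphism_mult[OF aut] automorphism_prod[OF aut]
    by (intro sum.cong prod.cong arg_cong2[of _ _ _ _ times] refl)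
       (simp_all only: lessThan_iff forms vfields)
qed

text \<open>The right-hand side is a component of the pullback of \<open>A\<^sub>\<tau>\<close> by \<open>\<phi>\<^sub>\<tau>\<close>, since evaluation at
  \<open>\<tau>\<close> turns \<open>\<phi>\<close> and \<open>\<phi>\<^bsup>-1\<^esup>\<close> into \<open>\<phi>\<^sub>\<tau>\<close> and \<open>\<phi>\<^sub>\<tau>\<^bsup>-1\<^esup>\<close>.\<close>

lemma eval_moving_component:
  assumes A: "A \<in> tensors time_vfields r s" and ev: "evaluative_tensor r s A"
    and len: "length is = r" "length js = s"
  shows "eval_at \<tau> (moving_component A is js) = (\<Sum>ks | length ks = r. \<Sum>ls | length ls = s.
    slice \<tau> (eval_at \<tau> (time_component A ks ls))
      * (\<Prod>k<r. slice \<tau> (pderiv_var (ks ! k) (inv (slice \<tau>) (mvar (is ! k)))))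
      * (\<Prod>k<s. pderiv_var (js ! k) (slice \<tau> (mvar (ls ! k)))))"
proof -
  let ?p = "\<lambda>ks k. \<phi> (pderiv_var (Some (ks ! k)) (inv \<phi> (mvar (Some (is ! k)))))"
  let ?t = "\<lambda>ks ls. \<phi> (time_component A ks ls) * (\<Prod>k<r. ?p ks k) * (\<Prod>k<s. jac (js ! k) (ls ! k))"
  have c: "evaluative (time_component A ks ls)" if "length ks = r" "length ls = s" for ks ls
    using ev that by (simp add: evaluative_tensor_def)
  have x: "eval_at \<tau> (mvar (Some i)) = mvar i" for i :: 'n
    using eval_at_embed[of \<tau> "mvar i"] by (simp only: embed_mvar)
  have p: "evaluative (?p ks k)" for ks k
    unfolding evaluative_image_iff
    by (intro evaluative_pderiv_Some evaluative_inv_image evaluative_mvar_Some)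
  have eval_p: "eval_at \<tau> (?p ks k) = slice \<tau> (pderiv_var (ks ! k) (inv (slice \<tau>) (mvar (is ! k))))" for ks k
    by (simp add: eval_image eval_inv_image eval_at_pderiv_Some evaluative_pderiv_Some
        evaluative_inv_image evaluative_mvar_Some x)
  have eval_jac: "eval_at \<tau> (jac j l) = pderiv_var j (slice \<tau> (mvar l))" for j l
    by (simp add: eval_at_pderiv_Some evaluative_image_var slice_mvar)
  have t: "evaluative (?t ks ls)" if "length ks = r" "length ls = s" for ks ls
    using that by (intro evaluative_mult evaluative_prod p evaluative_jac)
      (simp add: evaluative_image_iff c)
  have "eval_at \<tau> (?t ks ls) = slice \<tau> (eval_at \<tau> (time_component A ks ls))
      * (\<Prod>k<r. slice \<tau> (pderiv_var (ks ! k) (inv (slice \<tau>) (mvar (is ! k)))))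
      * (\<Prod>k<s. pderiv_var (js ! k) (slice \<tau> (mvar (ls ! k))))"
    if "length ks = r" "length ls = s" for ks ls
    using c[OF that]
    by (simp add: eval_at_mult eval_at_prod evaluative_mult evaluative_prod p evaluative_jac
        evaluative_image_iff[THEN iffD2] eval_p eval_jac) (simp add: eval_image)
  note eval_t = this
  have "eval_at \<tau> (moving_component A is js) =
      (\<Sum>ks | length ks = r. eval_at \<tau> (\<Sum>ls | length ls = s. ?t ks ls))"
    unfolding moving_component_expand[OF A len]
    by (rule eval_at_sum, rule evaluative_sum, rule t) simp_all
  also have "\<dots> = (\<Sum>ks | length ks = r. \<Sum>ls | length ls = s. eval_at \<tau> (?t ks ls))"
    by (rule sum.cong[OF refl], rule eval_at_sum, rule t) simp_all
  also have "\<dots> = (\<Sum>ks | length ks = r. \<Sum>ls | length ls = s.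
      slice \<tau> (eval_at \<tau> (time_component A ks ls))
        * (\<Prod>k<r. slice \<tau> (pderiv_var (ks ! k) (inv (slice \<tau>) (mvar (is ! k)))))
        * (\<Prod>k<s. pderiv_var (js ! k) (slice \<tau> (mvar (ls ! k)))))"
    by (rule sum.cong[OF refl], rule sum.cong[OF refl], rule eval_t) simp_all
  finally show ?thesis .
qed

lemma pullback_slice_tensor_at:
  assumes A: "A \<in> tensors time_vfields r s" and ev: "evaluative_tensor r s A"
  shows "pullback_tensor (slice \<tau>) (tensor_at r s \<tau> A) =
    tensor_of_components r s (\<lambda>is js. eval_at \<tau> (moving_component A is js))"
proof -
  have "pullback_tensor (slice \<tau>) (tensor_at r s \<tau> A) =
    tensor_of_components r s (\<lambda>is js. \<Sum>ks | length ks = r. \<Sum>ls | length ls = s.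
      slice \<tau> (eval_at \<tau> (time_component A ks ls))
        * (\<Prod>k<r. slice \<tau> (pderiv_var (ks ! k) (inv (slice \<tau>) (mvar (is ! k)))))
        * (\<Prod>k<s. pderiv_var (js ! k) (slice \<tau> (mvar (ls ! k)))))"
    unfolding tensor_at_def by (rule pullback_tensor_of_components[OF slice_automorphism])
  also have "\<dots> = tensor_of_components r s (\<lambda>is js. eval_at \<tau> (moving_component A is js))"
    by (rule tensor_of_components_cong) (rule eval_moving_component[OF A ev, symmetric])
  finally show ?thesis .
qed

lemma slice_0:
  assumes "is_flow X \<phi>"
  shows "slice 0 = id"
proof
  fix f
  have "evaluative (\<phi> (embed f))" by (simp add: evaluative_image_iff evaluative_embed)
  then show "slice 0 f = id f"
    using assms by (simp add: slice_def eval_at_zero_eq_at_time_zero is_flow_def)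
qed

text \<open>The flow equation is only given on series without \<open>t\<close>. Both sides are derivations, so it is enough
  to compare them on the variables; on \<open>t\<close> both equal \<open>1\<close>.\<close>

lemma flow_conjugates_time_derivative:
  assumes X: "X \<in> time_vfields" and flow: "is_flow X \<phi>"
  shows "inv \<phi> (pderiv_var None (\<phi> f)) = pderiv_var None f + X f"
proof -
  have dX: "K_derivation X" and Xt: "X tvar = 0" using X by (auto simp: time_vfields_def)
  have "(\<lambda>f. inv \<phi> (pderiv_var None (\<phi> f))) = pderiv_var None + X"
  proof (rule K_derivation_eqI)
    show "K_derivation (\<lambda>f. inv \<phi> (pderiv_var None (\<phi> f)))"
      by (rule K_derivation_conjugate[OF aut K_derivation_pderiv_var])
    show "K_derivation (pderiv_var None + X)"
      by (rule K_derivation_add[OF K_derivation_pderiv_var dX])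
    show "inv \<phi> (pderiv_var None (\<phi> (mvar v))) = (pderiv_var None + X) (mvar v)" for v
    proof (cases v)
      case None
      then show ?thesis
        by (simp add: image_tvar pderiv_var_mvar Xt automorphism_1[OF automorphism_inverse[OF aut]])
    next
      case (Some i)
      have "pderiv_var None (\<phi> (embed (mvar i))) = \<phi> (X (embed (mvar i)))"
        using flow by (simp add: is_flow_def)
      then show ?thesis
        by (simp add: Some embed_mvar automorphism_inv[OF aut] pderiv_var_mvar)
    qed
  qed
  from fun_cong[OF this, of f] show ?thesis by simp
qed

text \<open>Conjugation by \<open>\<phi>\<close> turns \<open>\<partial>/\<partial>t\<close> into \<open>\<partial>/\<partial>t + X\<close>. The arguments of \<open>A\<close> in a moving component are
  conjugates of \<open>\<partial>/\<partial>x\<^sup>j\<close> and \<open>dx\<^sup>i\<close>, which are invariant under \<open>\<partial>/\<partial>t\<close>, so they are invariant under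
  \<open>\<partial>/\<partial>t + X\<close>, and \<open>A\<close> is invariant by hypothesis.\<close>

lemma moving_component_constant:
  assumes A: "A \<in> tensors time_vfields r s" and X: "X \<in> time_vfields" and flow: "is_flow X \<phi>"
    and L: "lie_derivative time_vfields r s (pderiv_var None) A + lie_derivative time_vfields r s X A = 0"
    and len: "length is = r" "length js = s"
  shows "pderiv_var None (moving_component A is js) = 0"
proof -
  let ?V = "time_vfields :: ('a, 'n option) mfps vfield set"
  let ?D = "pderiv_var None :: ('a, 'n option) mfps vfield"
  let ?\<theta> = "\<lambda>i. coord_form ?V (inv \<phi> (mvar (Some i)))"
  let ?Y = "\<lambda>j f. inv \<phi> (pderiv_var (Some j) (\<phi> f))"
  note Z = flow_conjugates_time_derivative[OF X flow]
  note inv_aut = automorphism_inverse[OF aut]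
  have deriv: "K_derivation W" if "W \<in> ?V" for W using that by (simp add: time_vfields_def)
  have br: "lie_bracket ?D W \<in> ?V" "lie_bracket X W \<in> ?V" if "W \<in> ?V" for W
    using X that by (auto intro: lie_bracket_in_time_vfields)
  have one_form: "?\<theta> i \<in> one_forms ?V" for i
    by (rule coordinate_module.coord_form_in_one_forms[OF coordinate_module_time])
  have "lie_form ?V ?D (?\<theta> i) + lie_form ?V X (?\<theta> i) = 0" for i
  proof
    fix W
    show "(lie_form ?V ?D (?\<theta> i) + lie_form ?V X (?\<theta> i)) W = 0 W"
    proof (cases "W \<in> ?V")
      case True
      let ?\<xi> = "inv \<phi> (mvar (Some i))"
      \<comment> \<open>The series \<open>\<phi>\<^bsup>-1\<^esup> x\<^sup>i\<close> is annihilated because \<open>x\<^sup>i\<close> does not depend on \<open>t\<close>.\<close>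
      have "?D ?\<xi> + X ?\<xi> = 0"
        by (simp add: automorphism_inv[OF aut] pderiv_var_mvar automorphism_0[OF inv_aut] flip: Z)
      then have "W (?D ?\<xi>) + W (X ?\<xi>) = 0"
        using K_derivationD(1)[OF deriv[OF True], of "?D ?\<xi>" "X ?\<xi>"]
        by (simp only: K_derivation_0_1[OF deriv[OF True]])
      then show ?thesis
        using True br[OF True] by (simp add: lie_form_def coord_form_def) (simp add: lie_bracket_def)
    qed (simp add: lie_form_def)
  qed
  then have forms: "lie_form ?V ?D \<omega> \<in> one_forms ?V \<and> lie_form ?V X \<omega> \<in> one_forms ?V \<and>
      lie_form ?V ?D \<omega> + lie_form ?V X \<omega> = 0" if "\<omega> \<in> set (map ?\<theta> is)" for \<omega>
    using that one_form X by (auto intro!: lie_form_in_one_forms)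
  have Y: "?Y j \<in> ?V" for j by (rule conjugated_pderiv_in_time_vfields)
  have "lie_bracket ?D (?Y j) + lie_bracket X (?Y j) = 0" for j
  proof
    fix f
    have "(lie_bracket ?D (?Y j) + lie_bracket X (?Y j)) f =
        (?D (?Y j f) + X (?Y j f)) - ?Y j (?D f + X f)"
      using K_derivationD(1)[OF deriv[OF Y]] by (simp add: lie_bracket_def)
    also have "\<dots> = 0"
      unfolding Z[symmetric] by (simp add: automorphism_inv[OF aut] pderiv_commute)
    finally show "(lie_bracket ?D (?Y j) + lie_bracket X (?Y j)) f = 0 f" by simp
  qed
  then have vfields: "lie_bracket ?D W \<in> ?V \<and> lie_bracket X W \<in> ?V \<and>
      lie_bracket ?D W + lie_bracket X W = 0" if "W \<in> set (map ?Y js)" for W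
    using that br[OF Y] by auto
  have "?D (A (map ?\<theta> is) (map ?Y js)) + X (A (map ?\<theta> is) (map ?Y js)) = 0"
    by (rule invariant_tensor_on_invariant_arguments[OF A moving_component_args[OF len] L forms vfields])
  then have "inv \<phi> (?D (moving_component A is js)) = 0"
    by (simp add: moving_component_def Z)
  then have "\<phi> (inv \<phi> (?D (moving_component A is js))) = \<phi> 0" by (rule arg_cong)
  then show ?thesis by (simp only: automorphism_inv[OF aut] automorphism_0[OF aut])
qed

end

theorem corollary2p19:
  fixes A :: "('a::field_char_0, 'n::finite option) mfps tensor"
    and X :: "('a, 'n option) mfps vfield"
    and \<phi> :: "('a, 'n option) mfps \<Rightarrow> ('a, 'n option) mfps"
    and r s :: nat
  assumes "A \<in> tensors time_vfields r s"
    and "evaluative_tensor r s A"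
    and "X \<in> time_vfields"
    and "is_flow X \<phi>"
    and "evaluative_isotopy \<phi>"
    and "lie_derivative time_vfields r s (pderiv_var None) A
         + lie_derivative time_vfields r s X A = 0"
  shows "\<forall>\<tau>. pullback_tensor (isotopy_at \<tau> \<phi>) (tensor_at r s \<tau> A) = tensor_at r s 0 A"
proof
  fix \<tau>
  interpret polynomial_isotopy \<phi> by (rule polynomial_isotopy.intro) (rule assms(5))
  have "eval_at \<tau> (moving_component A is js) = eval_at 0 (moving_component A is js)"
    if "length is = r" "length js = s" for "is" js
    by (rule eval_at_constant_in_time(2)[OF
        moving_component_constant[OF assms(1,3,4,6) that]])
  then have "tensor_of_components r s (\<lambda>is js. eval_at \<tau> (moving_component A is js)) =
      tensor_of_components r s (\<lambda>is js. eval_at 0 (moving_component A is js))"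
    by (rule tensor_of_components_cong)
  then have "pullback_tensor (isotopy_at \<tau> \<phi>) (tensor_at r s \<tau> A) =
      pullback_tensor (slice 0) (tensor_at r s 0 A)"
    by (simp add: isotopy_at_eq_slice pullback_slice_tensor_at[OF assms(1,2)])
  also have "\<dots> = tensor_at r s 0 A"
  proof -
    have id: "pullback_vfield id = (id :: ('a, 'n) mfps vfield \<Rightarrow> _)"
      by (simp add: fun_eq_iff pullback_vfield_def)
    have "pullback_form id = (id :: ('a, 'n) mfps oneform \<Rightarrow> _)"
      by (simp add: fun_eq_iff pullback_form_def id)
    with id show ?thesis
      by (simp add: slice_0[OF assms(4)] pullback_tensor_def)
  qed
  finally show "pullback_tensor (isotopy_at \<tau> \<phi>) (tensor_at r s \<tau> A) = tensor_at r s 0 A" .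
qed

end
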